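(* Let $A = B \times H$ be a biproduct over a field $k$. If $\mathrm{Im}(\nu) \subseteq \mathrm{Aut}_{\mathcal{YD}-\mathrm{Hopf}}(B)$, then the map $$\Phi_{\mathcal{YD}} : \mathcal{N}(B, H)^{op} \rtimes_\varphi \mathrm{Aut}_{\mathcal{YD}-\mathrm{Hopf}}(B) \longrightarrow \mathrm{Aut}_{\mathrm{Hopf}}(A, \pi), \qquad \Phi_{\mathcal{YD}}(g, f)(b \times h) = f(b)g(h_{(1)}) \times h_{(2)},$$ is an isomorphism of groups.
   Context: Let $k$ be a field and $H$ a Hopf algebra over $k$. Sweedler notation: $\Delta(c) = c_{(1)} \otimes c_{(2)}$; for a left $H$-comodule $(M,\rho)$, $\rho(m) = m_{(-1)} \otimes m_{(0)} \in H \otimes M$. Biproduct. $B$ is a vector space which is an algebra, a coalgebra, a left $H$-module and a left $H$-comodule over $k$, such that: $B$ is a left $H$-module algebra, left $H$-module coalgebra, left $H$-comodule algebra, and left $H$-comodule coalgebra ($b_{(-1)}\epsilon(b_{(0)}) = \epsilon(b)1$, $b_{(1)(-1)}b_{(2)(-1)} \otimes b_{(1)(0)} \otimes b_{(2)(0)} = b_{(-1)} \otimes b_{(0)(1)} \otimes b_{(0)(2)}$); $\epsilon : B \to k$ is an algebra map and $\Delta(1) = 1 \otimes 1$; $\Delta(bb') = b_{(1)}(b_{(2)(-1)}\cdot b'_{(1)}) \otimes b_{(2)(0)}b'_{(2)}$; $h_{(1)}b_{(-1)} \otimes h_{(2)}\cdot b_{(0)} = (h_{(1)}\cdot b)_{(-1)}h_{(2)}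 \otimes (h_{(1)}\cdot b)_{(0)}$; and $\mathrm{Id}_B$ has a convolution inverse. (Equivalently, $B$ is a Hopf algebra in ${}_H^H\mathcal{YD}$.) The biproduct $A = B \times H$ is the Hopf algebra over $k$ with underlying space $B \otimes H$ (tensors written $b \times h$), product $(b \times h)(b' \times h') = b(h_{(1)}\cdot b') \times h_{(2)}h'$, unit $1 \times 1$, coproduct $\Delta(b \times h) = (b_{(1)} \times b_{(2)(-1)}h_{(1)}) \otimes (b_{(2)(0)} \times h_{(2)})$ and counit $\epsilon \otimes \epsilon$. Maps: $\pi : A \to H$, $\pi(b \times h) = \epsilon(b)h$; $j : H \to A$, $j(h) = 1 \times h$; $\Pi : A \to B$, $\Pi(b \times h) = b\epsilon(h)$; $J : B \to A$, $J(b) = b \times 1$. $\mathrm{Aut}_{\mathrm{Hopf}}(A, \pi)$ is the group (under composition) of Hopf algebra automorphisms $F$ of $A$ with $\pi \circ F = \pi$. For such $F$ put $F_L = \Pi \circ F \circ J : B \to B$ and $F_R = \Pi \circ F \circ j : H \to B$. $\nu : \mathrm{Aut}_{\mathrm{Hopf}}(A, \pi) \to \mathrm{Aut}_{\mathrm{Alg}}(B)$ is the group homomorphism $\nu(F) = F_L$. $\mathrm{Aut}_{\mathcal{YD}-\mathrm{Hopf}}(B)$ is the group of bijective linear endomorphisms of $B$ which are algebra, coalgebra, left $H$-module and left $H$-comodule maps. $\mathcal{N}(B, H)$ is the set of all $F_R$ with $F \in \mathrm{Aut}_{\mathrm{Hopf}}(A, \pi)$ and $F_L = \mathrm{Id}_B$;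 it is a group under the convolution product $\star$ of $\mathrm{Hom}(H,B)$. For a group $G$, $G^{op}$ denotes the opposite group. $\varphi(f)(g) = f \circ g$ for $f \in \mathrm{Aut}_{\mathcal{YD}-\mathrm{Hopf}}(B)$, $g \in \mathcal{N}(B,H)$, is an action by group automorphisms, and the semidirect product has multiplication $(g,f)(g',f') = ((f \circ g') \star g,\ f \circ f')$. *)

theory Defs
  imports "HOL-Algebra.Module" "HOL-Algebra.Bij"
begin

section \<open>Tensor products of vector spaces\<close>

text \<open>
  A tensor is a class of formal sums \<open>v\<^sub>1 \<otimes> w\<^sub>1 + \<dots> + v\<^sub>n \<otimes> w\<^sub>n\<close>, written as lists of pairs, modulo the
  congruence generated by commutativity of the sum and bilinearity. No formal negatives
  or formal scalars are needed, since \<open>c (v \<otimes> w) = (c v) \<otimes> w\<close>. The results at the end of this section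
  are the universal property.
\<close>

type_synonym ('v, 'w) tens = "('v \<times> 'w) list set"

inductive_set tensor_rel ::
    "('k, 'r) ring_scheme \<Rightarrow> ('k, 'v, 'm) module_scheme \<Rightarrow> ('k, 'w, 'n) module_scheme \<Rightarrow>
      (('v \<times> 'w) list \<times> ('v \<times> 'w) list) set"
  for K and V and W
where
  refl: "xs \<in> lists (carrier V \<times> carrier W) \<Longrightarrow> (xs, xs) \<in> tensor_rel K V W"
| sym: "(xs, ys) \<in> tensor_rel K V W \<Longrightarrow> (ys, xs) \<in> tensor_rel K V W"
| trans: "\<lbrakk>(xs, ys) \<in> tensor_rel K V W; (ys, zs) \<in> tensor_rel K V W\<rbrakk> \<Longrightarrow>
    (xs, zs) \<in> tensor_rel K V W"
| append: "\<lbrakk>(xs, xs') \<in> tensor_rel K V W; (ys, ys') \<in> tensor_rel K V W\<rbrakk> \<Longrightarrow>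
    (xs @ ys, xs' @ ys') \<in> tensor_rel K V W"
| comm: "\<lbrakk>xs \<in> lists (carrier V \<times> carrier W); ys \<in> lists (carrier V \<times> carrier W)\<rbrakk> \<Longrightarrow>
    (xs @ ys, ys @ xs) \<in> tensor_rel K V W"
| zero: "w \<in> carrier W \<Longrightarrow> ([(\<zero>\<^bsub>V\<^esub>, w)], []) \<in> tensor_rel K V W"
| add_left: "\<lbrakk>v \<in> carrier V; v' \<in> carrier V; w \<in> carrier W\<rbrakk> \<Longrightarrow>
    ([(v \<oplus>\<^bsub>V\<^esub> v', w)], [(v, w), (v', w)]) \<in> tensor_rel K V W"
| add_right: "\<lbrakk>v \<in> carrier V; w \<in> carrier W; w' \<in> carrier W\<rbrakk> \<Longrightarrow>
    ([(v, w \<oplus>\<^bsub>W\<^esub> w')], [(v, w), (v, w')]) \<in> tensor_rel K V W"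
| smult: "\<lbrakk>c \<in> carrier K; v \<in> carrier V; w \<in> carrier W\<rbrakk> \<Longrightarrow>
    ([(c \<odot>\<^bsub>V\<^esub> v, w)], [(v, c \<odot>\<^bsub>W\<^esub> w)]) \<in> tensor_rel K V W"

definition tens ::
    "('k, 'r) ring_scheme \<Rightarrow> ('k, 'v, 'm) module_scheme \<Rightarrow> ('k, 'w, 'n) module_scheme \<Rightarrow>
      'v \<Rightarrow> 'w \<Rightarrow> ('v, 'w) tens"
  where "tens K V W v w = tensor_rel K V W `` {[(v, w)]}"

text \<open>
  The product and unit below are those of the tensor product of two algebras,
  \<open>(v \<otimes> w)(v' \<otimes> w') = vv' \<otimes> ww'\<close>. They carry no meaning if \<open>V\<close> or \<open>W\<close> is only a vector space.
\<close>

definition tensor_product ::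
    "('k, 'r) ring_scheme \<Rightarrow> ('k, 'v, 'm) module_scheme \<Rightarrow> ('k, 'w, 'n) module_scheme \<Rightarrow>
      ('k, ('v, 'w) tens) module"
  where "tensor_product K V W =
    \<lparr>carrier = lists (carrier V \<times> carrier W) // tensor_rel K V W,
     mult = (\<lambda>s t. \<Union>xs\<in>s. \<Union>ys\<in>t.
       tensor_rel K V W `` {[(v \<otimes>\<^bsub>V\<^esub> v', w \<otimes>\<^bsub>W\<^esub> w'). (v, w) \<leftarrow> xs, (v', w') \<leftarrow> ys]}),
     one = tens K V W \<one>\<^bsub>V\<^esub> \<one>\<^bsub>W\<^esub>,
     zero = tensor_rel K V W `` {[]},
     add = (\<lambda>s t. \<Union>xs\<in>s. \<Union>ys\<in>t. tensor_rel K V W `` {xs @ ys}),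
     smult = (\<lambda>c t. \<Union>xs\<in>t. tensor_rel K V W `` {map (\<lambda>(v, w). (c \<odot>\<^bsub>V\<^esub> v, w)) xs})\<rparr>"

fun list_sum :: "('u, 'm) ring_scheme \<Rightarrow> ('v \<Rightarrow> 'w \<Rightarrow> 'u) \<Rightarrow> ('v \<times> 'w) list \<Rightarrow> 'u" where
  "list_sum U f [] = \<zero>\<^bsub>U\<^esub>"
| "list_sum U f ((v, w) # xs) = f v w \<oplus>\<^bsub>U\<^esub> list_sum U f xs"

text \<open>
  If \<open>t = \<Sum>\<^sub>i v\<^sub>i \<otimes> w\<^sub>i\<close>, then \<open>tensor_sum U t f = \<Sum>\<^sub>i f v\<^sub>i w\<^sub>i\<close>, computed in \<open>U\<close>. For bilinear \<open>f\<close> this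
  does not depend on the chosen representative. It renders Sweedler notation:
  \<open>f(c\<^sub>(\<^sub>1\<^sub>), c\<^sub>(\<^sub>2\<^sub>))\<close> becomes \<open>tensor_sum U (\<Delta> c) (\<lambda>c1 c2. f c1 c2)\<close>.
\<close>

definition tensor_sum ::
    "('u, 'm) ring_scheme \<Rightarrow> ('v, 'w) tens \<Rightarrow> ('v \<Rightarrow> 'w \<Rightarrow> 'u) \<Rightarrow> 'u"
  where "tensor_sum U t f = list_sum U f (SOME xs. xs \<in> t)"

definition linear_maps ::
    "('k, 'r) ring_scheme \<Rightarrow> ('k, 'v, 'm) module_scheme \<Rightarrow> ('k, 'w, 'n) module_scheme \<Rightarrow> ('v \<Rightarrow> 'w) set"
  where "linear_maps K V W = {f \<in> carrier V \<rightarrow> carrier W.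
    (\<forall>x\<in>carrier V. \<forall>y\<in>carrier V. f (x \<oplus>\<^bsub>V\<^esub> y) = f x \<oplus>\<^bsub>W\<^esub> f y) \<and>
    (\<forall>c\<in>carrier K. \<forall>x\<in>carrier V. f (c \<odot>\<^bsub>V\<^esub> x) = c \<odot>\<^bsub>W\<^esub> f x)}"

definition bilinear_maps ::
    "('k, 'r) ring_scheme \<Rightarrow> ('k, 'v, 'm) module_scheme \<Rightarrow> ('k, 'w, 'n) module_scheme \<Rightarrow>
      ('k, 'u, 'l) module_scheme \<Rightarrow> ('v \<Rightarrow> 'w \<Rightarrow> 'u) set"
  where "bilinear_maps K V W U = {f.
    (\<forall>v\<in>carrier V. f v \<in> linear_maps K W U) \<and>
    (\<forall>w\<in>carrier W. (\<lambda>v. f v w) \<in> linear_maps K V U)}"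

definition base_module :: "('k, 'r) ring_scheme \<Rightarrow> ('k, 'k) module"
  where "base_module K =
    \<lparr>carrier = carrier K, mult = mult K, one = one K, zero = zero K, add = add K, smult = mult K\<rparr>"

lemma tensor_rel_lists:
  assumes "module K V" "module K W" "(xs, ys) \<in> tensor_rel K V W"
  shows "xs \<in> lists (carrier V \<times> carrier W) \<and> ys \<in> lists (carrier V \<times> carrier W)"
proof -
  interpret V: module K V by fact
  interpret W: module K W by fact
  show ?thesis using assms(3)
    by (induction rule: tensor_rel.induct) auto
qed

lemma equiv_tensor_rel:
  assumes "module K V" "module K W"
  shows "equiv (lists (carrier V \<times> carrier W)) (tensor_rel K V W)"
proof (rule equivI)
  show "tensor_rel K V W \<subseteq> lists (carrier V \<times> carrier W) \<times> lists (carrier V \<times> carrier W)"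
    using tensor_rel_lists[OF assms] by (intro subsetI, clarify) blast
qed (auto intro!: refl_onI symI transI intro: tensor_rel.intros)

lemma list_sum_closed:
  assumes "abelian_group U" "\<And>v w. \<lbrakk>v \<in> carrier V; w \<in> carrier W\<rbrakk> \<Longrightarrow> f v w \<in> carrier U"
    and "xs \<in> lists (carrier V \<times> carrier W)"
  shows "list_sum U f xs \<in> carrier U"
proof -
  interpret U: abelian_group U by fact
  show ?thesis using assms(3) by (induction xs) (auto simp: assms(2))
qed

lemma list_sum_append:
  assumes "abelian_group U" "\<And>v w. \<lbrakk>v \<in> carrier V; w \<in> carrier W\<rbrakk> \<Longrightarrow> f v w \<in> carrier U"
    and "xs \<in> lists (carrier V \<times> carrier W)" "ys \<in> lists (carrier V \<times> carrier W)"
  shows "list_sum U f (xs @ ys) = list_sum U f xs \<oplus>\<^bsub>U\<^esub> list_sum U f ys"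
proof -
  interpret U: abelian_group U by fact
  have c: "list_sum U f zs \<in> carrier U" if "zs \<in> lists (carrier V \<times> carrier W)" for zs
    by (rule list_sum_closed[OF assms(1,2) that])
  show ?thesis using assms(3)
    by (induction xs rule: lists.induct)
      (auto simp: assms(2) U.a_assoc c[unfolded in_lists_conv_set] assms(4)[unfolded in_lists_conv_set])
qed

lemma list_sum_cong:
  assumes V: "module K V" and W: "module K W" and U: "module K U"
    and f: "f \<in> bilinear_maps K V W U" and r: "(xs, ys) \<in> tensor_rel K V W"
  shows "list_sum U f xs = list_sum U f ys"
proof -
  interpret V: module K V by fact
  interpret W: module K W by fact
  interpret U: module K U by fact
  have cl: "\<And>v w. \<lbrakk>v \<in> carrier V; w \<in> carrier W\<rbrakk> \<Longrightarrow> f v w \<in> carrier U"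
    and l: "\<And>v v' w. \<lbrakk>v \<in> carrier V; v' \<in> carrier V; w \<in> carrier W\<rbrakk> \<Longrightarrow>
        f (v \<oplus>\<^bsub>V\<^esub> v') w = f v w \<oplus>\<^bsub>U\<^esub> f v' w"
    and r': "\<And>v w w'. \<lbrakk>v \<in> carrier V; w \<in> carrier W; w' \<in> carrier W\<rbrakk> \<Longrightarrow>
        f v (w \<oplus>\<^bsub>W\<^esub> w') = f v w \<oplus>\<^bsub>U\<^esub> f v w'"
    and s: "\<And>c v w. \<lbrakk>c \<in> carrier K; v \<in> carrier V; w \<in> carrier W\<rbrakk> \<Longrightarrow>
        f (c \<odot>\<^bsub>V\<^esub> v) w = f v (c \<odot>\<^bsub>W\<^esub> w)"
    using f unfolding bilinear_maps_def linear_maps_def by auto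
  have z: "f \<zero>\<^bsub>V\<^esub> w = \<zero>\<^bsub>U\<^esub>" if "w \<in> carrier W" for w
    using l[of "\<zero>\<^bsub>V\<^esub>" "\<zero>\<^bsub>V\<^esub>" w] that cl[of "\<zero>\<^bsub>V\<^esub>" w] by simp
  have U': "abelian_group U" ..
  from r show ?thesis
  proof (induction rule: tensor_rel.induct)
    case (append xs xs' ys ys')
    then show ?case
      using tensor_rel_lists[OF V W append.hyps(1)] tensor_rel_lists[OF V W append.hyps(2)]
      by (simp add: list_sum_append[OF U' cl])
  next
    case (comm xs ys)
    then show ?case
      by (simp add: list_sum_append[OF U' cl] list_sum_closed[OF U' cl] U.a_comm)
  qed (auto simp: cl l r' s z)
qed

lemma tensor_sum_class:
  assumes V: "module K V" and W: "module K W" and U: "module K U"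
    and f: "f \<in> bilinear_maps K V W U" and xs: "xs \<in> lists (carrier V \<times> carrier W)"
  shows "tensor_sum U (tensor_rel K V W `` {xs}) f = list_sum U f xs"
proof -
  have "xs \<in> tensor_rel K V W `` {xs}" using xs by (auto intro: tensor_rel.refl)
  then have "(SOME ys. ys \<in> tensor_rel K V W `` {xs}) \<in> tensor_rel K V W `` {xs}"
    by (rule someI)
  then have "(xs, SOME ys. ys \<in> tensor_rel K V W `` {xs}) \<in> tensor_rel K V W"
    by blast
  from list_sum_cong[OF V W U f this] show ?thesis
    unfolding tensor_sum_def by simp
qed

lemma tensor_sum_tens:
  assumes "module K V" "module K W" "module K U" "f \<in> bilinear_maps K V W U"
    and "v \<in> carrier V" "w \<in> carrier W"
  shows "tensor_sum U (tens K V W v w) f = f v w"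
proof -
  interpret U: module K U by fact
  have "f v w \<in> carrier U"
    using assms(4-6) unfolding bilinear_maps_def linear_maps_def by auto
  then show ?thesis
    unfolding tens_def by (subst tensor_sum_class[OF assms(1-4)]) (auto simp: assms(5,6))
qed

lemma tensor_rel_map_smult:
  assumes V: "module K V" and W: "module K W" and c: "c \<in> carrier K"
    and r: "(xs, ys) \<in> tensor_rel K V W"
  shows "(map (\<lambda>(v, w). (c \<odot>\<^bsub>V\<^esub> v, w)) xs, map (\<lambda>(v, w). (c \<odot>\<^bsub>V\<^esub> v, w)) ys) \<in> tensor_rel K V W"
proof -
  interpret V: module K V by fact
  interpret W: module K W by fact
  have L: "map (\<lambda>(v, w). (c \<odot>\<^bsub>V\<^esub> v, w)) zs \<in> lists (carrier V \<times> carrier W)"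
    if "zs \<in> lists (carrier V \<times> carrier W)" for zs
    using that c by (induction zs) auto
  from r show ?thesis
  proof (induction rule: tensor_rel.induct)
    case (refl xs) then show ?case by (intro tensor_rel.refl L)
  next
    case (sym xs ys) show ?case by (rule tensor_rel.sym) (rule sym.IH)
  next
    case (trans xs ys zs) show ?case by (rule tensor_rel.trans) (rule trans.IH)+
  next
    case (append xs xs' ys ys') then show ?case by (simp add: tensor_rel.append)
  next
    case (comm xs ys) then show ?case by (simp only: map_append) (intro tensor_rel.comm L)
  next
    case (zero w) then show ?case using c by (simp add: V.smult_r_null tensor_rel.zero)
  next
    case (add_left v v' w)
    then show ?case using c by (simp add: V.smult_r_distr tensor_rel.add_left)
  next
    case (add_right v w w')
    then show ?case using c by (simp add: tensor_rel.add_right)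
  next
    case (smult d v w)
    have "c \<odot>\<^bsub>V\<^esub> (d \<odot>\<^bsub>V\<^esub> v) = d \<odot>\<^bsub>V\<^esub> (c \<odot>\<^bsub>V\<^esub> v)"
      using smult c by (simp add: V.R.m_comm flip: V.smult_assoc1)
    then show ?case using smult c by (simp add: tensor_rel.smult)
  qed
qed

lemma tensor_product_add:
  assumes V: "module K V" and W: "module K W"
    and "xs \<in> lists (carrier V \<times> carrier W)" "ys \<in> lists (carrier V \<times> carrier W)"
  shows "tensor_rel K V W `` {xs} \<oplus>\<^bsub>tensor_product K V W\<^esub> tensor_rel K V W `` {ys} =
    tensor_rel K V W `` {xs @ ys}"
proof -
  note E = equiv_tensor_rel[OF V W]
  have "congruent2 (tensor_rel K V W) (tensor_rel K V W) (\<lambda>xs ys. tensor_rel K V W `` {xs @ ys})"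
    unfolding congruent2_def using equiv_class_eq[OF E tensor_rel.append] by blast
  from UN_equiv_class2[OF E E this assms(3,4)] show ?thesis
    unfolding tensor_product_def by simp
qed

lemma tensor_product_smult:
  assumes V: "module K V" and W: "module K W" and c: "c \<in> carrier K"
    and "xs \<in> lists (carrier V \<times> carrier W)"
  shows "c \<odot>\<^bsub>tensor_product K V W\<^esub> (tensor_rel K V W `` {xs}) =
    tensor_rel K V W `` {map (\<lambda>(v, w). (c \<odot>\<^bsub>V\<^esub> v, w)) xs}"
proof -
  note E = equiv_tensor_rel[OF V W]
  have "congruent (tensor_rel K V W)
      (\<lambda>xs. tensor_rel K V W `` {map (\<lambda>(v, w). (c \<odot>\<^bsub>V\<^esub> v, w)) xs})"
    unfolding congruent_def using equiv_class_eq[OF E tensor_rel_map_smult[OF V W c]] by blast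
  from UN_equiv_class[OF E this assms(4)] show ?thesis
    unfolding tensor_product_def by simp
qed

lemma tensor_product_module:
  assumes V: "module K V" and W: "module K W"
  shows "module K (tensor_product K V W)"
proof -
  interpret V: module K V by fact
  interpret W: module K W by fact
  let ?T = "tensor_product K V W" and ?L = "lists (carrier V \<times> carrier W)"
  let ?cls = "\<lambda>xs. tensor_rel K V W `` {xs}" and ?s = "\<lambda>c. map (\<lambda>(v, w). (c \<odot>\<^bsub>V\<^esub> v, w))"
  note eq = equiv_class_eq[OF equiv_tensor_rel[OF V W]]
  note add = tensor_product_add[OF V W] and smult = tensor_product_smult[OF V W]
  have car: "carrier ?T = ?L // tensor_rel K V W" and zero: "\<zero>\<^bsub>?T\<^esub> = ?cls []"
    unfolding tensor_product_def by simp_all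
  have cl: "?cls xs \<in> carrier ?T" if "xs \<in> ?L" for xs
    unfolding car using that by (rule quotientI)
  have rep: "\<exists>xs\<in>?L. x = ?cls xs" if "x \<in> carrier ?T" for x
    using that unfolding car by (metis quotientE)
  have L: "?s c xs \<in> ?L" if "c \<in> carrier K" "xs \<in> ?L" for c xs
    using that(2,1) by (induction xs) auto
  have app: "xs @ ys \<in> ?L" if "xs \<in> ?L" "ys \<in> ?L" for xs ys
    using that by simp
  have neg: "(?s (\<ominus>\<^bsub>K\<^esub> \<one>\<^bsub>K\<^esub>) xs @ xs, []) \<in> tensor_rel K V W" if "xs \<in> ?L" for xs
    using that
  proof (induction xs rule: lists.induct)
    case Nil
    show ?case by (simp add: tensor_rel.refl)
  next
    case (Cons a xs)
    then obtain v w where a: "a = (v, w)" "v \<in> carrier V" "w \<in> carrier W" by auto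
    let ?m = "\<ominus>\<^bsub>K\<^esub> \<one>\<^bsub>K\<^esub>"
    let ?v = "(?m \<odot>\<^bsub>V\<^esub> v, w)"
    have m: "?m \<in> carrier K" by simp
    have v: "[?v] \<in> ?L" "[a] \<in> ?L" using a m by auto
    have "?m \<odot>\<^bsub>V\<^esub> v \<oplus>\<^bsub>V\<^esub> v = \<zero>\<^bsub>V\<^esub>"
      using a by (simp add: V.smult_l_minus V.l_neg)
    then have "([?v] @ [a], []) \<in> tensor_rel K V W"
      using tensor_rel.sym[OF tensor_rel.add_left[of "?m \<odot>\<^bsub>V\<^esub> v" V v w W K]]
        tensor_rel.zero[of w W V K] a m by (auto intro: tensor_rel.trans)
    moreover have "([?v] @ (?s ?m xs @ [a]) @ xs, [?v] @ ([a] @ ?s ?m xs) @ xs) \<in> tensor_rel K V W"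
      using v Cons.hyps L[OF m, of xs] by (intro tensor_rel.append tensor_rel.comm tensor_rel.refl)
    ultimately show ?case
      using tensor_rel.append[OF _ Cons.IH, of "[?v] @ [a]" "[]"] a(1)
      by (auto intro: tensor_rel.trans)
  qed
  have dist: "(?s (c \<oplus>\<^bsub>K\<^esub> d) xs, ?s c xs @ ?s d xs) \<in> tensor_rel K V W"
    if c: "c \<in> carrier K" and d: "d \<in> carrier K" and "xs \<in> ?L" for c d xs
    using that(3)
  proof (induction xs rule: lists.induct)
    case Nil
    show ?case by (simp add: tensor_rel.refl)
  next
    case (Cons a xs)
    then obtain v w where a: "a = (v, w)" "v \<in> carrier V" "w \<in> carrier W" by auto
    let ?c = "(c \<odot>\<^bsub>V\<^esub> v, w)" and ?d = "(d \<odot>\<^bsub>V\<^esub> v, w)"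
    have v: "[?c] \<in> ?L" "[?d] \<in> ?L" using a c d by auto
    have "([((c \<oplus>\<^bsub>K\<^esub> d) \<odot>\<^bsub>V\<^esub> v, w)], [?c, ?d]) \<in> tensor_rel K V W"
      using a c d by (simp add: V.smult_l_distr tensor_rel.add_left)
    from tensor_rel.append[OF this Cons.IH]
    have "(?s (c \<oplus>\<^bsub>K\<^esub> d) (a # xs), [?c, ?d] @ ?s c xs @ ?s d xs) \<in> tensor_rel K V W"
      by (simp add: a(1))
    moreover have "([?c] @ ([?d] @ ?s c xs) @ ?s d xs, [?c] @ (?s c xs @ [?d]) @ ?s d xs)
        \<in> tensor_rel K V W"
      using v Cons.hyps L[OF c, of xs] L[OF d, of xs]
      by (intro tensor_rel.append tensor_rel.comm tensor_rel.refl)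
    ultimately show ?case
      by (auto simp: a(1) intro: tensor_rel.trans)
  qed
  show ?thesis
  proof (rule moduleI)
    show "cring K" ..
    show "abelian_group ?T"
    proof (rule abelian_groupI)
      fix x y z assume "x \<in> carrier ?T" "y \<in> carrier ?T" "z \<in> carrier ?T"
      then obtain xs ys zs where "xs \<in> ?L" "x = ?cls xs" "ys \<in> ?L" "y = ?cls ys"
        "zs \<in> ?L" "z = ?cls zs" using rep by meson
      then show "(x \<oplus>\<^bsub>?T\<^esub> y) \<oplus>\<^bsub>?T\<^esub> z = x \<oplus>\<^bsub>?T\<^esub> (y \<oplus>\<^bsub>?T\<^esub> z)"
        by (simp only: add app append_assoc)
    next
      fix x y assume "x \<in> carrier ?T" "y \<in> carrier ?T"
      then obtain xs ys where xy: "xs \<in> ?L" "x = ?cls xs" "ys \<in> ?L" "y = ?cls ys"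
        using rep by meson
      then show "x \<oplus>\<^bsub>?T\<^esub> y \<in> carrier ?T"
        by (simp only: add app cl)
      show "x \<oplus>\<^bsub>?T\<^esub> y = y \<oplus>\<^bsub>?T\<^esub> x"
        using xy eq[OF tensor_rel.comm] by (simp only: add)
    next
      show "\<zero>\<^bsub>?T\<^esub> \<in> carrier ?T" unfolding zero by (rule cl) simp
    next
      fix x assume "x \<in> carrier ?T"
      then obtain xs where xs: "xs \<in> ?L" "x = ?cls xs" using rep by meson
      then show "\<zero>\<^bsub>?T\<^esub> \<oplus>\<^bsub>?T\<^esub> x = x"
        unfolding zero by (simp only: add lists.Nil append_Nil)
      have m: "\<ominus>\<^bsub>K\<^esub> \<one>\<^bsub>K\<^esub> \<in> carrier K" by simp
      have "?cls (?s (\<ominus>\<^bsub>K\<^esub> \<one>\<^bsub>K\<^esub>) xs) \<oplus>\<^bsub>?T\<^esub> x = \<zero>\<^bsub>?T\<^esub>"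
        unfolding zero xs(2) using eq[OF neg[OF xs(1)]] by (simp only: add L[OF m] xs(1))
      then show "\<exists>y\<in>carrier ?T. y \<oplus>\<^bsub>?T\<^esub> x = \<zero>\<^bsub>?T\<^esub>"
        using cl[OF L[OF m xs(1)]] by blast
    qed
  next
    fix c x assume c: "c \<in> carrier K" and "x \<in> carrier ?T"
    then obtain xs where xs: "xs \<in> ?L" "x = ?cls xs" using rep by meson
    show "c \<odot>\<^bsub>?T\<^esub> x \<in> carrier ?T"
      unfolding xs(2) smult[OF c xs(1)] by (rule cl[OF L[OF c xs(1)]])
    fix d assume d: "d \<in> carrier K"
    show "(c \<oplus>\<^bsub>K\<^esub> d) \<odot>\<^bsub>?T\<^esub> x = c \<odot>\<^bsub>?T\<^esub> x \<oplus>\<^bsub>?T\<^esub> d \<odot>\<^bsub>?T\<^esub> x"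
      unfolding xs(2) using c d xs(1) eq[OF dist[OF c d xs(1)]]
      by (simp only: smult add L V.R.add.m_closed)
    have "?s (c \<otimes>\<^bsub>K\<^esub> d) xs = ?s c (?s d xs)"
      using xs(1) c d by (induction xs) (auto simp: V.smult_assoc1)
    then show "(c \<otimes>\<^bsub>K\<^esub> d) \<odot>\<^bsub>?T\<^esub> x = c \<odot>\<^bsub>?T\<^esub> (d \<odot>\<^bsub>?T\<^esub> x)"
      unfolding xs(2) using c d xs(1) by (simp only: smult L V.R.m_closed)
  next
    fix c x y assume c: "c \<in> carrier K" and "x \<in> carrier ?T" "y \<in> carrier ?T"
    then obtain xs ys where xy: "xs \<in> ?L" "x = ?cls xs" "ys \<in> ?L" "y = ?cls ys"
      using rep by meson
    then show "c \<odot>\<^bsub>?T\<^esub> (x \<oplus>\<^bsub>?T\<^esub> y) = c \<odot>\<^bsub>?T\<^esub> x \<oplus>\<^bsub>?T\<^esub> c \<odot>\<^bsub>?T\<^esub> y"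
      using c by (simp only: smult add L app map_append)
  next
    fix x assume "x \<in> carrier ?T"
    then obtain xs where xs: "xs \<in> ?L" "x = ?cls xs" using rep by meson
    have "?s \<one>\<^bsub>K\<^esub> xs = xs"
      using xs(1) by (induction xs) auto
    then show "\<one>\<^bsub>K\<^esub> \<odot>\<^bsub>?T\<^esub> x = x"
      unfolding xs(2) using xs(1) by (simp only: smult V.R.one_closed)
  qed
qed

lemma tensor_induct [consumes 3, case_names zero tens_add]:
  assumes V: "module K V" and W: "module K W" and t: "t \<in> carrier (tensor_product K V W)"
    and zero: "P \<zero>\<^bsub>tensor_product K V W\<^esub>"
    and tens_add: "\<And>v w t. \<lbrakk>v \<in> carrier V; w \<in> carrier W; t \<in> carrier (tensor_product K V W); P t\<rbrakk> \<Longrightarrow>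
      P (tens K V W v w \<oplus>\<^bsub>tensor_product K V W\<^esub> t)"
  shows "P t"
proof -
  let ?T = "tensor_product K V W" and ?L = "lists (carrier V \<times> carrier W)"
  have car: "carrier ?T = ?L // tensor_rel K V W" and z: "\<zero>\<^bsub>?T\<^esub> = tensor_rel K V W `` {[]}"
    unfolding tensor_product_def by simp_all
  obtain xs where xs: "xs \<in> ?L" "t = tensor_rel K V W `` {xs}"
    using t unfolding car by (rule quotientE)
  from xs(1) have "P (tensor_rel K V W `` {xs})"
  proof (induction xs rule: lists.induct)
    case Nil
    then show ?case using zero by (simp add: z)
  next
    case (Cons a xs)
    then obtain v w where a: "a = (v, w)" "v \<in> carrier V" "w \<in> carrier W" by auto
    have "tensor_rel K V W `` {a # xs} = tens K V W v w \<oplus>\<^bsub>?T\<^esub> tensor_rel K V W `` {xs}"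
      unfolding tens_def using a Cons.hyps by (subst tensor_product_add[OF V W]) auto
    moreover have "tensor_rel K V W `` {xs} \<in> carrier ?T"
      unfolding car using Cons.hyps by (intro quotientI)
    ultimately show ?case
      using tens_add[OF a(2,3) _ Cons.IH] by simp
  qed
  then show ?thesis by (simp add: xs(2))
qed

lemma tens_bilinear:
  assumes V: "module K V" and W: "module K W"
  shows "tens K V W \<in> bilinear_maps K V W (tensor_product K V W)"
proof -
  interpret V: module K V by fact
  interpret W: module K W by fact
  note E = equiv_tensor_rel[OF V W]
  note eq = equiv_class_eq[OF E]
  have cl: "tens K V W v w \<in> carrier (tensor_product K V W)"
    if "v \<in> carrier V" "w \<in> carrier W" for v w
    using that unfolding tensor_product_def tens_def by (simp add: quotientI)
  have smult: "tens K V W (c \<odot>\<^bsub>V\<^esub> v) w = c \<odot>\<^bsub>tensor_product K V W\<^esub> tens K V W v w"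
    if "c \<in> carrier K" "v \<in> carrier V" "w \<in> carrier W" for c v w
    unfolding tens_def by (subst tensor_product_smult[OF V W]) (use that in auto)
  have bal: "tens K V W v (c \<odot>\<^bsub>W\<^esub> w) = tens K V W (c \<odot>\<^bsub>V\<^esub> v) w"
    if "c \<in> carrier K" "v \<in> carrier V" "w \<in> carrier W" for c v w
    unfolding tens_def using eq[OF tensor_rel.smult[OF that]] by simp
  have add_left: "tens K V W (v \<oplus>\<^bsub>V\<^esub> v') w =
      tens K V W v w \<oplus>\<^bsub>tensor_product K V W\<^esub> tens K V W v' w"
    if "v \<in> carrier V" "v' \<in> carrier V" "w \<in> carrier W" for v v' w
    unfolding tens_def using eq[OF tensor_rel.add_left[OF that]]
    by (subst tensor_product_add[OF V W]) (use that in auto)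
  have add_right: "tens K V W v (w \<oplus>\<^bsub>W\<^esub> w') =
      tens K V W v w \<oplus>\<^bsub>tensor_product K V W\<^esub> tens K V W v w'"
    if "v \<in> carrier V" "w \<in> carrier W" "w' \<in> carrier W" for v w w'
    unfolding tens_def using eq[OF tensor_rel.add_right[OF that]]
    by (subst tensor_product_add[OF V W]) (use that in auto)
  show ?thesis
    unfolding bilinear_maps_def linear_maps_def
    by (auto simp: cl smult bal add_left add_right)
qed

lemma tensor_sum_linear:
  assumes V: "module K V" and W: "module K W" and U: "module K U"
    and f: "f \<in> bilinear_maps K V W U"
  shows "(\<lambda>t. tensor_sum U t f) \<in> linear_maps K (tensor_product K V W) U"
proof -
  interpret V: module K V by fact
  interpret W: module K W by fact
  interpret U: module K U by fact
  have U': "abelian_group U" ..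
  let ?L = "lists (carrier V \<times> carrier W)"
  have cl: "\<And>v w. \<lbrakk>v \<in> carrier V; w \<in> carrier W\<rbrakk> \<Longrightarrow> f v w \<in> carrier U"
    and s: "\<And>c v w. \<lbrakk>c \<in> carrier K; v \<in> carrier V; w \<in> carrier W\<rbrakk> \<Longrightarrow>
        f (c \<odot>\<^bsub>V\<^esub> v) w = c \<odot>\<^bsub>U\<^esub> f v w"
    using f unfolding bilinear_maps_def linear_maps_def by auto
  have car: "carrier (tensor_product K V W) = ?L // tensor_rel K V W"
    unfolding tensor_product_def by simp
  note sum = tensor_sum_class[OF V W U f]
  have ls: "list_sum U f (map (\<lambda>(v, w). (c \<odot>\<^bsub>V\<^esub> v, w)) xs) = c \<odot>\<^bsub>U\<^esub> list_sum U f xs"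
    if c: "c \<in> carrier K" and xs: "xs \<in> ?L" for c xs
    using xs by (induction xs)
      (auto simp: c s cl U.smult_r_distr list_sum_closed[OF U' cl, unfolded in_lists_conv_set]
        U.smult_r_null)
  have L: "map (\<lambda>(v, w). (c \<odot>\<^bsub>V\<^esub> v, w)) xs \<in> ?L" if "c \<in> carrier K" "xs \<in> ?L" for c xs
    using that(2) that(1) by (induction xs) auto
  show ?thesis
    unfolding linear_maps_def car
  proof (intro CollectI conjI ballI)
    show "(\<lambda>t. tensor_sum U t f) \<in> ?L // tensor_rel K V W \<rightarrow> carrier U"
      by (rule Pi_I, erule quotientE) (simp add: sum list_sum_closed[OF U' cl])
  next
    fix x y assume "x \<in> ?L // tensor_rel K V W" "y \<in> ?L // tensor_rel K V W"
    then obtain xs ys where "xs \<in> ?L" "x = tensor_rel K V W `` {xs}"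
      "ys \<in> ?L" "y = tensor_rel K V W `` {ys}"
      by (meson quotientE)
    then show "tensor_sum U (x \<oplus>\<^bsub>tensor_product K V W\<^esub> y) f = tensor_sum U x f \<oplus>\<^bsub>U\<^esub> tensor_sum U y f"
      by (simp add: sum tensor_product_add[OF V W] list_sum_append[OF U' cl] del: append_in_lists_conv)
        (simp add: sum list_sum_append[OF U' cl])
  next
    fix c x assume c: "c \<in> carrier K" and "x \<in> ?L // tensor_rel K V W"
    then obtain xs where "xs \<in> ?L" "x = tensor_rel K V W `` {xs}"
      by (meson quotientE)
    then show "tensor_sum U (c \<odot>\<^bsub>tensor_product K V W\<^esub> x) f = c \<odot>\<^bsub>U\<^esub> tensor_sum U x f"
      using c by (simp only: sum tensor_product_smult[OF V W c] L ls)
  qed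
qed

section \<open>Hopf algebras\<close>

record ('k, 'c) coalg = "('k, 'c) module" +
  comult :: "'c \<Rightarrow> ('c, 'c) tens"
  counit :: "'c \<Rightarrow> 'k"

locale unital_algebra = field K + module K A + ring A for K (structure) and A (structure) +
  assumes smult_mult_left: "\<lbrakk>c \<in> carrier K; x \<in> carrier A; y \<in> carrier A\<rbrakk> \<Longrightarrow>
      (c \<odot>\<^bsub>A\<^esub> x) \<otimes>\<^bsub>A\<^esub> y = c \<odot>\<^bsub>A\<^esub> (x \<otimes>\<^bsub>A\<^esub> y)"
    and smult_mult_right: "\<lbrakk>c \<in> carrier K; x \<in> carrier A; y \<in> carrier A\<rbrakk> \<Longrightarrow>
      x \<otimes>\<^bsub>A\<^esub> (c \<odot>\<^bsub>A\<^esub> y) = c \<odot>\<^bsub>A\<^esub> (x \<otimes>\<^bsub>A\<^esub> y)"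

locale coalgebra = field K + module K C for K (structure) and C (structure) +
  assumes comult_linear: "comult C \<in> linear_maps K C (tensor_product K C C)"
    and counit_linear: "counit C \<in> linear_maps K C (base_module K)"
    and coassoc: "c \<in> carrier C \<Longrightarrow>
      tensor_sum (tensor_product K C (tensor_product K C C)) (comult C c) (\<lambda>c1 c2.
        tensor_sum (tensor_product K C (tensor_product K C C)) (comult C c1) (\<lambda>c11 c12.
          tens K C (tensor_product K C C) c11 (tens K C C c12 c2))) =
      tensor_sum (tensor_product K C (tensor_product K C C)) (comult C c) (\<lambda>c1 c2.
        tens K C (tensor_product K C C) c1 (comult C c2))"
    and counit_left: "c \<in> carrier C \<Longrightarrow>
      tensor_sum C (comult C c) (\<lambda>c1 c2. counit C c1 \<odot>\<^bsub>C\<^esub> c2) = c"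
    and counit_right: "c \<in> carrier C \<Longrightarrow>
      tensor_sum C (comult C c) (\<lambda>c1 c2. counit C c2 \<odot>\<^bsub>C\<^esub> c1) = c"

definition conv ::
    "('k, 'c, 'm) coalg_scheme \<Rightarrow> ('k, 'a, 'n) module_scheme \<Rightarrow> ('c \<Rightarrow> 'a) \<Rightarrow> ('c \<Rightarrow> 'a) \<Rightarrow> 'c \<Rightarrow> 'a"
  where "conv C A f g = (\<lambda>c\<in>carrier C. tensor_sum A (comult C c) (\<lambda>c1 c2. f c1 \<otimes>\<^bsub>A\<^esub> g c2))"

definition conv_one ::
    "('k, 'c, 'm) coalg_scheme \<Rightarrow> ('k, 'a, 'n) module_scheme \<Rightarrow> 'c \<Rightarrow> 'a"
  where "conv_one C A = (\<lambda>c\<in>carrier C. counit C c \<odot>\<^bsub>A\<^esub> \<one>\<^bsub>A\<^esub>)"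

definition id_conv_invertible ::
    "('k, 'r) ring_scheme \<Rightarrow> ('k, 'a, 'm) coalg_scheme \<Rightarrow> bool"
  where "id_conv_invertible K A \<longleftrightarrow>
    (\<exists>S\<in>linear_maps K A A. conv A A S (\<lambda>a. a) = conv_one A A \<and> conv A A (\<lambda>a. a) S = conv_one A A)"

locale hopf_algebra = unital_algebra K H + coalgebra K H for K (structure) and H (structure) +
  assumes comult_hom: "comult H \<in> ring_hom H (tensor_product K H H)"
    and counit_hom: "counit H \<in> ring_hom H K"
    and antipode: "id_conv_invertible K H"

definition algebra_maps ::
    "('k, 'r) ring_scheme \<Rightarrow> ('k, 'a, 'm) module_scheme \<Rightarrow> ('k, 'b, 'n) module_scheme \<Rightarrow> ('a \<Rightarrow> 'b) set"
  where "algebra_maps K A A' = ring_hom A A' \<inter> linear_maps K A A'"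

definition coalgebra_maps ::
    "('k, 'r) ring_scheme \<Rightarrow> ('k, 'c, 'm) coalg_scheme \<Rightarrow> ('k, 'd, 'n) coalg_scheme \<Rightarrow> ('c \<Rightarrow> 'd) set"
  where "coalgebra_maps K C D = {f \<in> linear_maps K C D. \<forall>c\<in>carrier C.
    comult D (f c) =
      tensor_sum (tensor_product K D D) (comult C c) (\<lambda>c1 c2. tens K D D (f c1) (f c2)) \<and>
    counit D (f c) = counit C c}"

text \<open>
  A bialgebra map between Hopf algebras automatically commutes with the antipodes.
\<close>

definition hopf_automorphisms ::
    "('k, 'r) ring_scheme \<Rightarrow> ('k, 'a, 'm) coalg_scheme \<Rightarrow> ('a \<Rightarrow> 'a) set"
  where "hopf_automorphisms K A =
    Bij (carrier A) \<inter> algebra_maps K A A \<inter> coalgebra_maps K A A"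


section \<open>Modules and comodules over a Hopf algebra\<close>

locale left_module = field K + hopf_algebra K H + module K M
  for K (structure) and H (structure) and M (structure) and act :: "'h \<Rightarrow> 'b \<Rightarrow> 'b" +
  assumes act_bilinear: "act \<in> bilinear_maps K H M M"
    and act_one: "m \<in> carrier M \<Longrightarrow> act \<one>\<^bsub>H\<^esub> m = m"
    and act_mult: "\<lbrakk>h \<in> carrier H; h' \<in> carrier H; m \<in> carrier M\<rbrakk> \<Longrightarrow>
      act (h \<otimes>\<^bsub>H\<^esub> h') m = act h (act h' m)"

locale left_comodule = field K + hopf_algebra K H + module K M
  for K (structure) and H (structure) and M (structure) and coact :: "'b \<Rightarrow> ('h, 'b) tens" +
  assumes coact_linear: "coact \<in> linear_maps K M (tensor_product K H M)"
    and coact_coassoc: "m \<in> carrier M \<Longrightarrow>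
      tensor_sum (tensor_product K H (tensor_product K H M)) (coact m) (\<lambda>x m0.
        tensor_sum (tensor_product K H (tensor_product K H M)) (comult H x) (\<lambda>x1 x2.
          tens K H (tensor_product K H M) x1 (tens K H M x2 m0))) =
      tensor_sum (tensor_product K H (tensor_product K H M)) (coact m) (\<lambda>x m0.
        tens K H (tensor_product K H M) x (coact m0))"
    and coact_counit: "m \<in> carrier M \<Longrightarrow>
      tensor_sum M (coact m) (\<lambda>x m0. counit H x \<odot>\<^bsub>M\<^esub> m0) = m"


section \<open>Biproducts\<close>

locale biproduct_datum =
  hopf_algebra K H + unital_algebra K B + coalgebra K B +
  left_module K H B act + left_comodule K H B coact
  for K (structure) and H (structure) and B (structure)
    and act :: "'h \<Rightarrow> 'b \<Rightarrow> 'b" and coact :: "'b \<Rightarrow> ('h, 'b) tens" +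
  assumes module_algebra_mult: "\<lbrakk>h \<in> carrier H; b \<in> carrier B; b' \<in> carrier B\<rbrakk> \<Longrightarrow>
      act h (b \<otimes>\<^bsub>B\<^esub> b') = tensor_sum B (comult H h) (\<lambda>h1 h2. act h1 b \<otimes>\<^bsub>B\<^esub> act h2 b')"
    and module_algebra_one: "h \<in> carrier H \<Longrightarrow> act h \<one>\<^bsub>B\<^esub> = counit H h \<odot>\<^bsub>B\<^esub> \<one>\<^bsub>B\<^esub>"
    and module_coalgebra_comult: "\<lbrakk>h \<in> carrier H; b \<in> carrier B\<rbrakk> \<Longrightarrow>
      comult B (act h b) =
      tensor_sum (tensor_product K B B) (comult H h) (\<lambda>h1 h2.
        tensor_sum (tensor_product K B B) (comult B b) (\<lambda>b1 b2.
          tens K B B (act h1 b1) (act h2 b2)))"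
    and module_coalgebra_counit: "\<lbrakk>h \<in> carrier H; b \<in> carrier B\<rbrakk> \<Longrightarrow>
      counit B (act h b) = counit H h \<otimes>\<^bsub>K\<^esub> counit B b"
    and comodule_algebra: "coact \<in> ring_hom B (tensor_product K H B)"
    and comodule_coalgebra_counit: "b \<in> carrier B \<Longrightarrow>
      tensor_sum H (coact b) (\<lambda>x b0. counit B b0 \<odot>\<^bsub>H\<^esub> x) = counit B b \<odot>\<^bsub>H\<^esub> \<one>\<^bsub>H\<^esub>"
    and comodule_coalgebra_comult: "b \<in> carrier B \<Longrightarrow>
      tensor_sum (tensor_product K H (tensor_product K B B)) (comult B b) (\<lambda>b1 b2.
        tensor_sum (tensor_product K H (tensor_product K B B)) (coact b1) (\<lambda>x c1.
          tensor_sum (tensor_product K H (tensor_product K B B)) (coact b2) (\<lambda>y c2.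
            tens K H (tensor_product K B B) (x \<otimes>\<^bsub>H\<^esub> y) (tens K B B c1 c2)))) =
      tensor_sum (tensor_product K H (tensor_product K B B)) (coact b) (\<lambda>x b0.
        tens K H (tensor_product K B B) x (comult B b0))"
    and counit_algebra_map: "counit B \<in> ring_hom B K"
    and comult_one: "comult B \<one>\<^bsub>B\<^esub> = tens K B B \<one>\<^bsub>B\<^esub> \<one>\<^bsub>B\<^esub>"
    and comult_mult: "\<lbrakk>b \<in> carrier B; b' \<in> carrier B\<rbrakk> \<Longrightarrow>
      comult B (b \<otimes>\<^bsub>B\<^esub> b') =
      tensor_sum (tensor_product K B B) (comult B b) (\<lambda>b1 b2.
        tensor_sum (tensor_product K B B) (coact b2) (\<lambda>x c.
          tensor_sum (tensor_product K B B) (comult B b') (\<lambda>b1' b2'.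
            tens K B B (b1 \<otimes>\<^bsub>B\<^esub> act x b1') (c \<otimes>\<^bsub>B\<^esub> b2'))))"
    and yetter_drinfeld: "\<lbrakk>h \<in> carrier H; b \<in> carrier B\<rbrakk> \<Longrightarrow>
      tensor_sum (tensor_product K H B) (comult H h) (\<lambda>h1 h2.
        tensor_sum (tensor_product K H B) (coact b) (\<lambda>x b0.
          tens K H B (h1 \<otimes>\<^bsub>H\<^esub> x) (act h2 b0))) =
      tensor_sum (tensor_product K H B) (comult H h) (\<lambda>h1 h2.
        tensor_sum (tensor_product K H B) (coact (act h1 b)) (\<lambda>x b0.
          tens K H B (x \<otimes>\<^bsub>H\<^esub> h2) b0))"
    and braided_antipode: "id_conv_invertible K B"

context
  fixes K :: "('k, 'r) ring_scheme"
    and H :: "('k, 'h, 'm) coalg_scheme"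
    and B :: "('k, 'b, 'n) coalg_scheme"
    and act :: "'h \<Rightarrow> 'b \<Rightarrow> 'b"
    and coact :: "'b \<Rightarrow> ('h, 'b) tens"
begin

abbreviation (input) BH where "BH \<equiv> tensor_product K B H"

definition biproduct :: "('k, ('b, 'h) tens) coalg"
  where "biproduct =
    \<lparr>carrier = carrier BH,
     mult = (\<lambda>x y. tensor_sum BH x (\<lambda>b h. tensor_sum BH y (\<lambda>b' h'.
       tensor_sum BH (comult H h) (\<lambda>h1 h2.
         tens K B H (b \<otimes>\<^bsub>B\<^esub> act h1 b') (h2 \<otimes>\<^bsub>H\<^esub> h'))))),
     one = tens K B H \<one>\<^bsub>B\<^esub> \<one>\<^bsub>H\<^esub>,
     zero = \<zero>\<^bsub>BH\<^esub>,
     add = add BH,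
     smult = smult BH,
     comult = (\<lambda>x. tensor_sum (tensor_product K BH BH) x (\<lambda>b h.
       tensor_sum (tensor_product K BH BH) (comult B b) (\<lambda>b1 b2.
         tensor_sum (tensor_product K BH BH) (coact b2) (\<lambda>y c.
           tensor_sum (tensor_product K BH BH) (comult H h) (\<lambda>h1 h2.
             tens K BH BH (tens K B H b1 (y \<otimes>\<^bsub>H\<^esub> h1)) (tens K B H c h2)))))),
     counit = (\<lambda>x. tensor_sum K x (\<lambda>b h. counit B b \<otimes>\<^bsub>K\<^esub> counit H h))\<rparr>"

definition proj_H :: "('b, 'h) tens \<Rightarrow> 'h"  \<comment> \<open>\<open>\<pi>\<close>\<close>
  where "proj_H x = tensor_sum H x (\<lambda>b h. counit B b \<odot>\<^bsub>H\<^esub> h)"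

definition incl_H :: "'h \<Rightarrow> ('b, 'h) tens"  \<comment> \<open>\<open>j\<close>\<close>
  where "incl_H h = tens K B H \<one>\<^bsub>B\<^esub> h"

definition proj_B :: "('b, 'h) tens \<Rightarrow> 'b"  \<comment> \<open>\<open>\<Pi>\<close>\<close>
  where "proj_B x = tensor_sum B x (\<lambda>b h. counit H h \<odot>\<^bsub>B\<^esub> b)"

definition incl_B :: "'b \<Rightarrow> ('b, 'h) tens"  \<comment> \<open>\<open>J\<close>\<close>
  where "incl_B b = tens K B H b \<one>\<^bsub>H\<^esub>"

definition left_part :: "(('b, 'h) tens \<Rightarrow> ('b, 'h) tens) \<Rightarrow> 'b \<Rightarrow> 'b"  \<comment> \<open>\<open>F\<^sub>L\<close>\<close>
  where "left_part F = (\<lambda>b\<in>carrier B. proj_B (F (incl_B b)))"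

definition right_part :: "(('b, 'h) tens \<Rightarrow> ('b, 'h) tens) \<Rightarrow> 'h \<Rightarrow> 'b"  \<comment> \<open>\<open>F\<^sub>R\<close>\<close>
  where "right_part F = (\<lambda>h\<in>carrier H. proj_B (F (incl_H h)))"

definition Aut_Hopf_pi :: "(('b, 'h) tens \<Rightarrow> ('b, 'h) tens) monoid"
  where "Aut_Hopf_pi = BijGroup (carrier biproduct)
    \<lparr>carrier := {F \<in> hopf_automorphisms K biproduct.
       \<forall>x\<in>carrier biproduct. proj_H (F x) = proj_H x}\<rparr>"

definition nu :: "(('b, 'h) tens \<Rightarrow> ('b, 'h) tens) \<Rightarrow> 'b \<Rightarrow> 'b"
  where "nu F = left_part F"

definition Aut_YD_Hopf :: "('b \<Rightarrow> 'b) monoid"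
  where "Aut_YD_Hopf = BijGroup (carrier B)
    \<lparr>carrier := {f \<in> Bij (carrier B) \<inter> algebra_maps K B B \<inter> coalgebra_maps K B B.
       (\<forall>h\<in>carrier H. \<forall>b\<in>carrier B. f (act h b) = act h (f b)) \<and>
       (\<forall>b\<in>carrier B. coact (f b) =
         tensor_sum (tensor_product K H B) (coact b) (\<lambda>x b0. tens K H B x (f b0)))}\<rparr>"

definition N_group :: "('h \<Rightarrow> 'b) monoid"
  where "N_group =
    \<lparr>carrier = {right_part F |F. F \<in> carrier Aut_Hopf_pi \<and> left_part F = (\<lambda>b\<in>carrier B. b)},
     mult = conv H B,
     one = conv_one H B\<rparr>"

definition phi :: "('b \<Rightarrow> 'b) \<Rightarrow> ('h \<Rightarrow> 'b) \<Rightarrow> 'h \<Rightarrow> 'b"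
  where "phi f g = compose (carrier H) f g"

definition Phi_YD :: "('h \<Rightarrow> 'b) \<times> ('b \<Rightarrow> 'b) \<Rightarrow> ('b, 'h) tens \<Rightarrow> ('b, 'h) tens"
  where "Phi_YD = (\<lambda>(g, f). \<lambda>x\<in>carrier biproduct.
    tensor_sum biproduct x (\<lambda>b h.
      tensor_sum biproduct (comult H h) (\<lambda>h1 h2. tens K B H (f b \<otimes>\<^bsub>B\<^esub> g h1) h2)))"

end


section \<open>Opposite groups and semidirect products\<close>

definition opposite_group :: "('a, 'm) monoid_scheme \<Rightarrow> 'a monoid"
  where "opposite_group G = \<lparr>carrier = carrier G, mult = (\<lambda>x y. y \<otimes>\<^bsub>G\<^esub> x), one = \<one>\<^bsub>G\<^esub>\<rparr>"

definition semidirect_product ::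
    "('n, 'r) monoid_scheme \<Rightarrow> ('q, 's) monoid_scheme \<Rightarrow> ('q \<Rightarrow> 'n \<Rightarrow> 'n) \<Rightarrow> ('n \<times> 'q) monoid"
  where "semidirect_product N Q \<theta> =
    \<lparr>carrier = carrier N \<times> carrier Q,
     mult = (\<lambda>(n, q) (n', q'). (n \<otimes>\<^bsub>N\<^esub> \<theta> q n', q \<otimes>\<^bsub>Q\<^esub> q')),
     one = (\<one>\<^bsub>N\<^esub>, \<one>\<^bsub>Q\<^esub>)\<rparr>"

end

theory Submission
  imports Defs
begin

text \<open>
  Let \<open>F\<close> be a Hopf algebra automorphism of \<open>A = B \<times> H\<close> with \<open>\<pi> \<circ> F = \<pi>\<close>. Every element of \<open>A\<close>
  satisfies \<open>x = \<Pi>(x\<^sub>(\<^sub>1\<^sub>)) \<times> \<pi>(x\<^sub>(\<^sub>2\<^sub>))\<close> (\<open>comult_reconstruct\<close>). Applied to \<open>F(x)\<close>, and with \<open>F\<close> a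
  coalgebra map over \<open>\<pi>\<close>, this gives \<open>F(b \<times> h) = \<Pi>(F(b \<times> h\<^sub>(\<^sub>1\<^sub>))) \<times> h\<^sub>(\<^sub>2\<^sub>)\<close>; since \<open>F\<close> is also
  multiplicative and \<open>b \<times> h = (b \<times> 1)(1 \<times> h)\<close>, one gets \<open>\<Pi>(F(b \<times> h)) = F\<^sub>L(b) F\<^sub>R(h)\<close>
  (\<open>to_B_automorphism\<close>). Hence \<open>F(b \<times> h) = F\<^sub>L(b) F\<^sub>R(h\<^sub>(\<^sub>1\<^sub>)) \<times> h\<^sub>(\<^sub>2\<^sub>)\<close>, that is,
  \<open>F = \<Phi>(F\<^sub>R, F\<^sub>L)\<close> (\<open>automorphism_formula\<close>, \<open>Phi_parts\<close>). Applying \<open>\<Pi> \<circ> F\<close> to the same formula for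
  \<open>F'\<close> gives \<open>(F \<circ> F')\<^sub>L = F\<^sub>L \<circ> F'\<^sub>L\<close> and \<open>(F \<circ> F')\<^sub>R = (F\<^sub>L \<circ> F'\<^sub>R) \<star> F\<^sub>R\<close>, which is the
  multiplication of the semidirect product.

  It remains to see that \<open>F \<mapsto> (F\<^sub>R, F\<^sub>L)\<close> is a bijection onto the semidirect product. The link is
  that \<open>f \<otimes> id\<close> is an automorphism of \<open>A\<close> over \<open>\<pi>\<close> for each Yetter-Drinfeld Hopf automorphism \<open>f\<close> of
  \<open>B\<close> (\<open>extend_automorphism\<close>), and that composing with it on the right keeps \<open>F\<^sub>R\<close> and replaces
  \<open>F\<^sub>L\<close> by \<open>F\<^sub>L \<circ> f\<close>. So if \<open>g = F\<^sub>R\<close> with \<open>F\<^sub>L\<close> the identity, then \<open>\<Phi>(g, f) = F \<circ> (f \<otimes> id)\<close> is an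
  automorphism. Conversely, for any \<open>F\<close> the hypothesis makes \<open>F\<^sub>L\<close> a Yetter-Drinfeld Hopf
  automorphism, and \<open>F \<circ> (F\<^sub>L \<otimes> id)\<^sup>-\<^sup>1\<close> has the same right part as \<open>F\<close> and the identity as left
  part, so that \<open>F\<^sub>R\<close> lies in \<open>\<N>(B, H)\<close>.

  Sweedler sums are handled by two devices: identities on tensor products are checked on pure
  tensors (\<open>linear_maps_tensor_eqI\<close>), and the bilinearity that this requires is derived by rules
  that follow the syntax of the expressions (\<open>multilinear\<close>).
\<close>

section \<open>Linear and bilinear maps\<close>

lemma linear_mapsI:
  assumes "\<And>x. x \<in> carrier V \<Longrightarrow> f x \<in> carrier W"
    and "\<And>x y. \<lbrakk>x \<in> carrier V; y \<in> carrier V\<rbrakk> \<Longrightarrow> f (x \<oplus>\<^bsub>V\<^esub> y) = f x \<oplus>\<^bsub>W\<^esub> f y"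
    and "\<And>c x. \<lbrakk>c \<in> carrier K; x \<in> carrier V\<rbrakk> \<Longrightarrow> f (c \<odot>\<^bsub>V\<^esub> x) = c \<odot>\<^bsub>W\<^esub> f x"
  shows "f \<in> linear_maps K V W"
  using assms unfolding linear_maps_def by auto

lemma linear_mapsD:
  assumes "f \<in> linear_maps K V W"
  shows "\<And>x. x \<in> carrier V \<Longrightarrow> f x \<in> carrier W"
    and "\<And>x y. \<lbrakk>x \<in> carrier V; y \<in> carrier V\<rbrakk> \<Longrightarrow> f (x \<oplus>\<^bsub>V\<^esub> y) = f x \<oplus>\<^bsub>W\<^esub> f y"
    and "\<And>c x. \<lbrakk>c \<in> carrier K; x \<in> carrier V\<rbrakk> \<Longrightarrow> f (c \<odot>\<^bsub>V\<^esub> x) = c \<odot>\<^bsub>W\<^esub> f x"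
  using assms unfolding linear_maps_def by auto

lemma linear_maps_zero:
  assumes "module K V" "module K W" "f \<in> linear_maps K V W"
  shows "f \<zero>\<^bsub>V\<^esub> = \<zero>\<^bsub>W\<^esub>"
proof -
  interpret V: module K V by fact
  interpret W: module K W by fact
  have "f \<zero>\<^bsub>V\<^esub> = f \<zero>\<^bsub>V\<^esub> \<oplus>\<^bsub>W\<^esub> f \<zero>\<^bsub>V\<^esub>"
    using linear_mapsD(2)[OF assms(3), of "\<zero>\<^bsub>V\<^esub>" "\<zero>\<^bsub>V\<^esub>"] by simp
  then show ?thesis
    using linear_mapsD(1)[OF assms(3) V.zero_closed] by (simp add: W.add.l_cancel_one')
qed

lemma bilinear_mapsI:
  assumes "\<And>v. v \<in> carrier V \<Longrightarrow> f v \<in> linear_maps K W U"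
    and "\<And>w. w \<in> carrier W \<Longrightarrow> (\<lambda>v. f v w) \<in> linear_maps K V U"
  shows "f \<in> bilinear_maps K V W U"
  using assms unfolding bilinear_maps_def by auto

lemma bilinear_mapsD:
  assumes "f \<in> bilinear_maps K V W U"
  shows "\<And>v. v \<in> carrier V \<Longrightarrow> f v \<in> linear_maps K W U"
    and "\<And>w. w \<in> carrier W \<Longrightarrow> (\<lambda>v. f v w) \<in> linear_maps K V U"
    and "\<And>v w. \<lbrakk>v \<in> carrier V; w \<in> carrier W\<rbrakk> \<Longrightarrow> f v w \<in> carrier U"
  using assms unfolding bilinear_maps_def linear_maps_def by auto

lemma linear_maps_compose:
  assumes "g \<in> linear_maps K W U" "f \<in> linear_maps K V W"
  shows "(\<lambda>x. g (f x)) \<in> linear_maps K V U"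
  using assms by (intro linear_mapsI) (simp_all add: linear_mapsD)

lemma linear_maps_id: "(\<lambda>x. x) \<in> linear_maps K V V"
  unfolding linear_maps_def by auto

lemma linear_maps_restrict:
  assumes "module K V" "f \<in> linear_maps K V W"
  shows "restrict f (carrier V) \<in> linear_maps K V W"
proof -
  interpret V: module K V by fact
  show ?thesis
    using linear_mapsD[OF assms(2)] by (intro linear_mapsI) auto
qed

lemma linear_maps_inv_into:
  assumes "module K V" "f \<in> linear_maps K V W" "bij_betw f (carrier V) (carrier W)"
  shows "inv_into (carrier V) f \<in> linear_maps K W V"
proof -
  interpret V: module K V by fact
  note inv = bij_betw_inv_into_right[OF assms(3)] bij_betw_apply[OF bij_betw_inv_into[OF assms(3)]]
  have eqI: "inv_into (carrier V) f y = x" if "x \<in> carrier V" "f x = y" for x y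
    using bij_betw_inv_into_left[OF assms(3) that(1)] that(2) by simp
  show ?thesis
    by (intro linear_mapsI eqI) (simp_all add: inv linear_mapsD[OF assms(2)])
qed

section \<open>Maps out of tensor products\<close>

lemma tens_closed:
  assumes "module K V" "module K W" "v \<in> carrier V" "w \<in> carrier W"
  shows "tens K V W v w \<in> carrier (tensor_product K V W)"
  by (rule bilinear_mapsD(3)[OF tens_bilinear[OF assms(1,2)] assms(3,4)])

text \<open>
  \<open>tensor_sum\<close> evaluates a formal sum picked out of the class. For an element of the tensor product
  that sum has its entries in the carriers. Closure, congruence and compatibility with linear maps
  are therefore proved for each formal sum separately.
\<close>

lemma tensor_representative:
  assumes "module K V" "module K W" "t \<in> carrier (tensor_product K V W)"
  shows "(SOME xs. xs \<in> t) \<in> lists (carrier V \<times> carrier W)"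
proof -
  obtain xs where xs: "xs \<in> lists (carrier V \<times> carrier W)" "t = tensor_rel K V W `` {xs}"
    using assms(3) unfolding tensor_product_def by simp (erule quotientE, blast)
  then have "xs \<in> t" by (auto intro: tensor_rel.refl)
  then have "(SOME xs. xs \<in> t) \<in> t" by (rule someI)
  then show ?thesis using tensor_rel_lists[OF assms(1,2)] xs(2) by blast
qed

lemma tensor_sum_closed:
  assumes "module K V" "module K W" "module K U" "t \<in> carrier (tensor_product K V W)"
    and "\<And>v w. \<lbrakk>v \<in> carrier V; w \<in> carrier W\<rbrakk> \<Longrightarrow> f v w \<in> carrier U"
  shows "tensor_sum U t f \<in> carrier U"
proof -
  interpret U: module K U by fact
  show ?thesis unfolding tensor_sum_def
    by (rule list_sum_closed[OF U.abelian_group_axioms assms(5) tensor_representative[OF assms(1,2,4)]])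
qed

lemma tensor_sum_cong:
  assumes "module K V" "module K W" "t \<in> carrier (tensor_product K V W)"
    and "\<And>v w. \<lbrakk>v \<in> carrier V; w \<in> carrier W\<rbrakk> \<Longrightarrow> f v w = g v w"
  shows "tensor_sum U t f = tensor_sum U t g"
proof -
  have "list_sum U f xs = list_sum U g xs" if "xs \<in> lists (carrier V \<times> carrier W)" for xs
    using that by (induction xs) (auto simp: assms(4))
  then show ?thesis
    unfolding tensor_sum_def using tensor_representative[OF assms(1-3)] by blast
qed

text \<open>
  Linear maps move into Sweedler sums. Applied to a map \<open>s \<mapsto> tensor_sum U s f\<close> this flattens nested
  sums, which is the second lemma; bilinearity of \<open>f\<close> makes that map linear.
\<close>

lemma linear_map_tensor_sum:
  assumes V: "module K V" and W: "module K W" and U: "module K U" and U': "module K U'"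
    and f: "f \<in> linear_maps K U U'" and t: "t \<in> carrier (tensor_product K V W)"
    and g: "\<And>v w. \<lbrakk>v \<in> carrier V; w \<in> carrier W\<rbrakk> \<Longrightarrow> g v w \<in> carrier U"
  shows "f (tensor_sum U t g) = tensor_sum U' t (\<lambda>v w. f (g v w))"
proof -
  interpret U: module K U by fact
  have "f (list_sum U g xs) = list_sum U' (\<lambda>v w. f (g v w)) xs"
    if "xs \<in> lists (carrier V \<times> carrier W)" for xs
    using that
  proof (induction xs rule: lists.induct)
    case Nil
    show ?case by (simp add: linear_maps_zero[OF U U' f])
  next
    case (Cons a xs)
    then show ?case
      using list_sum_closed[OF U.abelian_group_axioms g Cons.hyps(2)]
      by (auto simp: linear_mapsD(2)[OF f] g)
  qed
  then show ?thesis
    unfolding tensor_sum_def using tensor_representative[OF V W t] by blast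
qed

lemma tensor_sum_tensor_sum:
  assumes "module K V" "module K W" "module K X" "module K Y" "module K U"
    and "f \<in> bilinear_maps K X Y U" "t \<in> carrier (tensor_product K V W)"
    and "\<And>v w. \<lbrakk>v \<in> carrier V; w \<in> carrier W\<rbrakk> \<Longrightarrow> g v w \<in> carrier (tensor_product K X Y)"
  shows "tensor_sum U (tensor_sum (tensor_product K X Y) t g) f =
    tensor_sum U t (\<lambda>v w. tensor_sum U (g v w) f)"
  by (rule linear_map_tensor_sum[OF assms(1,2) tensor_product_module[OF assms(3,4)] assms(5)
      tensor_sum_linear[OF assms(3-6)] assms(7,8)])

text \<open>
  The uniqueness part of the universal property. It reduces every identity of linear maps on the
  biproduct to tensors \<open>b \<otimes> h\<close>.
\<close>

lemma linear_maps_tensor_eqI: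
  assumes V: "module K V" and W: "module K W" and U: "module K U"
    and f: "f \<in> linear_maps K (tensor_product K V W) U"
      and g: "g \<in> linear_maps K (tensor_product K V W) U"
    and eq: "\<And>v w. \<lbrakk>v \<in> carrier V; w \<in> carrier W\<rbrakk> \<Longrightarrow> f (tens K V W v w) = g (tens K V W v w)"
    and t: "t \<in> carrier (tensor_product K V W)"
  shows "f t = g t"
  using V W t
proof (induction rule: tensor_induct)
  case zero
  show ?case
    using linear_maps_zero[OF tensor_product_module[OF V W] U f]
      linear_maps_zero[OF tensor_product_module[OF V W] U g] by simp
next
  case (tens_add v w t)
  then show ?case
    using tens_closed[OF V W] by (simp add: linear_mapsD(2)[OF f] linear_mapsD(2)[OF g] eq)
qed

text \<open>
  The following rules read off linearity from the syntax of a Sweedler expression. A variable may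
  sit in the tensor that is summed over or in the summand; each case has its own rule, so the shape
  of the expression determines which one applies.
\<close>

lemma linear_maps_tensor_sum_left:
  assumes "t \<in> linear_maps K X (tensor_product K V W)" "f \<in> bilinear_maps K V W U"
    and "module K V" "module K W" "module K U"
  shows "(\<lambda>x. tensor_sum U (t x) f) \<in> linear_maps K X U"
  by (rule linear_maps_compose[OF tensor_sum_linear[OF assms(3-5,2)] assms(1)])

lemma linear_maps_tensor_sum_right:
  assumes t: "t \<in> carrier (tensor_product K V W)"
    and f: "\<And>v w. \<lbrakk>v \<in> carrier V; w \<in> carrier W\<rbrakk> \<Longrightarrow> (\<lambda>x. f x v w) \<in> linear_maps K X U"
    and V: "module K V" and W: "module K W" and U: "module K U"
  shows "(\<lambda>x. tensor_sum U t (f x)) \<in> linear_maps K X U"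
proof -
  interpret U: module K U by fact
  have "(\<lambda>x. list_sum U (f x) xs) \<in> linear_maps K X U" if "xs \<in> lists (carrier V \<times> carrier W)" for xs
    using that
  proof (induction xs rule: lists.induct)
    case Nil
    show ?case by (rule linear_mapsI) (simp_all add: U.smult_r_null)
  next
    case (Cons a xs)
    then obtain v w where a: "a = (v, w)" "v \<in> carrier V" "w \<in> carrier W" by auto
    note l = linear_mapsD[OF f[OF a(2,3)]] linear_mapsD[OF Cons.IH]
    show ?case
      by (rule linear_mapsI) (simp_all add: a(1) l U.a_ac U.smult_r_distr)
  qed
  from this[OF tensor_representative[OF V W t]] show ?thesis
    unfolding tensor_sum_def .
qed

lemma linear_maps_tens_left:
  assumes "f \<in> linear_maps K X V" "w \<in> carrier W" "module K V" "module K W"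
  shows "(\<lambda>x. tens K V W (f x) w) \<in> linear_maps K X (tensor_product K V W)"
  by (rule linear_maps_compose[OF bilinear_mapsD(2)[OF tens_bilinear[OF assms(3,4)] assms(2)] assms(1)])

lemma linear_maps_tens_right:
  assumes "f \<in> linear_maps K X W" "v \<in> carrier V" "module K V" "module K W"
  shows "(\<lambda>x. tens K V W v (f x)) \<in> linear_maps K X (tensor_product K V W)"
  by (rule linear_maps_compose[OF bilinear_mapsD(1)[OF tens_bilinear[OF assms(3,4)] assms(2)] assms(1)])

lemma linear_maps_smult_left:
  assumes "f \<in> linear_maps K X (base_module K)" "u \<in> carrier U" "module K U"
  shows "(\<lambda>x. f x \<odot>\<^bsub>U\<^esub> u) \<in> linear_maps K X U"
proof -
  interpret U: module K U by fact
  show ?thesis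
    using linear_mapsD[OF assms(1)] assms(2)
    by (intro linear_mapsI) (simp_all add: base_module_def U.smult_l_distr U.smult_assoc1)
qed

lemma linear_maps_smult_right:
  assumes "f \<in> linear_maps K X U" "c \<in> carrier K" "module K U"
  shows "(\<lambda>x. c \<odot>\<^bsub>U\<^esub> f x) \<in> linear_maps K X U"
proof -
  interpret U: module K U by fact
  show ?thesis
    using linear_mapsD[OF assms(1)] assms(2)
    by (intro linear_mapsI) (simp_all add: U.smult_r_distr U.R.m_comm flip: U.smult_assoc1)
qed

lemma linear_maps_mult_left:
  assumes "f \<in> linear_maps K X A" "a \<in> carrier A" "unital_algebra K A"
  shows "(\<lambda>x. f x \<otimes>\<^bsub>A\<^esub> a) \<in> linear_maps K X A"
proof -
  interpret A: unital_algebra K A by fact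
  show ?thesis
    using linear_mapsD[OF assms(1)] assms(2)
    by (intro linear_mapsI) (simp_all add: A.l_distr A.smult_mult_left)
qed

lemma linear_maps_mult_right:
  assumes "f \<in> linear_maps K X A" "a \<in> carrier A" "unital_algebra K A"
  shows "(\<lambda>x. a \<otimes>\<^bsub>A\<^esub> f x) \<in> linear_maps K X A"
proof -
  interpret A: unital_algebra K A by fact
  show ?thesis
    using linear_mapsD[OF assms(1)] assms(2)
    by (intro linear_mapsI) (simp_all add: A.r_distr A.smult_mult_right)
qed

lemma base_module_module: "cring K \<Longrightarrow> module K (base_module K)"
proof -
  assume "cring K"
  then interpret cring K .
  interpret a: abelian_group "base_module K"
    by (rule abelian_groupI) (auto simp: base_module_def a_ac intro: bexI[OF _ a_inv_closed] l_neg)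
  show ?thesis
    by unfold_locales (auto simp: base_module_def l_distr r_distr m_assoc)
qed

lemma tensor_map_bilinear:
  assumes "module K X" "module K Y" "f \<in> linear_maps K V X" "g \<in> linear_maps K W Y"
  shows "(\<lambda>v w. tens K X Y (f v) (g w)) \<in> bilinear_maps K V W (tensor_product K X Y)"
  using assms
  by (intro bilinear_mapsI linear_maps_tens_left linear_maps_tens_right) (simp_all add: linear_mapsD)

lemma tensor_sum_tens_self:
  assumes V: "module K V" and W: "module K W" and t: "t \<in> carrier (tensor_product K V W)"
  shows "tensor_sum (tensor_product K V W) t (tens K V W) = t"
  by (rule linear_maps_tensor_eqI[OF V W tensor_product_module[OF V W] _ linear_maps_id _ t])
    (simp_all add: V W tensor_product_module tens_bilinear tensor_sum_linear tensor_sum_tens)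

section \<open>Hopf algebra automorphisms over a map\<close>

lemma hopf_automorphisms_iff:
  "F \<in> hopf_automorphisms K A \<longleftrightarrow>
    F \<in> extensional (carrier A) \<and> bij_betw F (carrier A) (carrier A) \<and> F \<in> linear_maps K A A \<and>
    (\<forall>x\<in>carrier A. \<forall>y\<in>carrier A. F (x \<otimes>\<^bsub>A\<^esub> y) = F x \<otimes>\<^bsub>A\<^esub> F y) \<and> F \<one>\<^bsub>A\<^esub> = \<one>\<^bsub>A\<^esub> \<and>
    (\<forall>x\<in>carrier A. comult A (F x) =
      tensor_sum (tensor_product K A A) (comult A x) (\<lambda>u v. tens K A A (F u) (F v))) \<and>
    (\<forall>x\<in>carrier A. counit A (F x) = counit A x)"
  unfolding hopf_automorphisms_def Bij_def algebra_maps_def coalgebra_maps_def ring_hom_def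
    linear_maps_def by blast

lemma hopf_automorphismsD:
  assumes "F \<in> hopf_automorphisms K A"
  shows "F \<in> extensional (carrier A)" "bij_betw F (carrier A) (carrier A)" "F \<in> linear_maps K A A"
    and "\<And>x. x \<in> carrier A \<Longrightarrow> F x \<in> carrier A"
    and "\<And>x y. \<lbrakk>x \<in> carrier A; y \<in> carrier A\<rbrakk> \<Longrightarrow> F (x \<otimes>\<^bsub>A\<^esub> y) = F x \<otimes>\<^bsub>A\<^esub> F y"
    and "F \<one>\<^bsub>A\<^esub> = \<one>\<^bsub>A\<^esub>"
    and "\<And>x. x \<in> carrier A \<Longrightarrow> comult A (F x) =
      tensor_sum (tensor_product K A A) (comult A x) (\<lambda>u v. tens K A A (F u) (F v))"
    and "\<And>x. x \<in> carrier A \<Longrightarrow> counit A (F x) = counit A x"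
  using assms bij_betw_apply unfolding hopf_automorphisms_iff by metis+

text \<open>
  For the comultiplication, both composition and inversion come down to functoriality of
  \<open>F \<mapsto> F \<otimes> F\<close>: if \<open>\<Delta> \<circ> F = (F \<otimes> F) \<circ> \<Delta>\<close> and \<open>F' \<circ> F\<close> is the identity, then applying \<open>F' \<otimes> F'\<close> gives
  \<open>\<Delta> = (F' \<otimes> F') \<circ> \<Delta> \<circ> F\<close>.
\<close>

lemma group_hopf_automorphisms_over:
  assumes A: "module K A"
    and one: "\<one>\<^bsub>A\<^esub> \<in> carrier A"
    and mult: "\<And>x y. \<lbrakk>x \<in> carrier A; y \<in> carrier A\<rbrakk> \<Longrightarrow> x \<otimes>\<^bsub>A\<^esub> y \<in> carrier A"
    and comult: "\<And>x. x \<in> carrier A \<Longrightarrow> comult A x \<in> carrier (tensor_product K A A)"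
  shows "group (BijGroup (carrier A)
    \<lparr>carrier := {F \<in> hopf_automorphisms K A. \<forall>x\<in>carrier A. p (F x) = p x}\<rparr>)"
proof -
  interpret A: module K A by fact
  let ?S = "{F \<in> hopf_automorphisms K A. \<forall>x\<in>carrier A. p (F x) = p x}"
  have tensor_map_compose: "tensor_sum (tensor_product K A A)
        (tensor_sum (tensor_product K A A) t (\<lambda>u v. tens K A A (F u) (F v)))
          (\<lambda>u v. tens K A A (G u) (G v)) =
      tensor_sum (tensor_product K A A) t (\<lambda>u v. tens K A A (G (F u)) (G (F v)))"
    if F: "F \<in> linear_maps K A A" and G: "G \<in> linear_maps K A A"
      and t: "t \<in> carrier (tensor_product K A A)" for F G t
  proof -
    have "tensor_sum (tensor_product K A A)
        (tensor_sum (tensor_product K A A) t (\<lambda>u v. tens K A A (F u) (F v)))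
          (\<lambda>u v. tens K A A (G u) (G v)) =
      tensor_sum (tensor_product K A A) t (\<lambda>u v. tensor_sum (tensor_product K A A)
        (tens K A A (F u) (F v)) (\<lambda>u v. tens K A A (G u) (G v)))"
      by (rule tensor_sum_tensor_sum[OF A A A A tensor_product_module[OF A A]
        tensor_map_bilinear[OF A A G G] t])
        (intro tens_closed A linear_mapsD(1)[OF F])
    also have "\<dots> = tensor_sum (tensor_product K A A) t (\<lambda>u v. tens K A A (G (F u)) (G (F v)))"
      by (intro tensor_sum_cong[OF A A t] tensor_sum_tens tensor_product_module A tensor_map_bilinear
        G linear_mapsD(1)[OF F])
    finally show ?thesis .
  qed
  have "subgroup ?S (BijGroup (carrier A))"
  proof (rule group.subgroupI[OF group_BijGroup])
    show "?S \<subseteq> carrier (BijGroup (carrier A))"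
      by (auto simp: hopf_automorphisms_iff BijGroup_def Bij_def)
    have "tensor_sum (tensor_product K A A) (comult A x)
        (\<lambda>u v. tens K A A ((\<lambda>x\<in>carrier A. x) u) ((\<lambda>x\<in>carrier A. x) v)) = comult A x"
      if "x \<in> carrier A" for x
      using tensor_sum_cong[OF A A comult[OF that], of _ "tens K A A" "tensor_product K A A"]
        tensor_sum_tens_self[OF A A comult[OF that]] by simp
    then have "(\<lambda>x\<in>carrier A. x) \<in> ?S"
      using linear_maps_restrict[OF A linear_maps_id]
      by (simp add: hopf_automorphisms_iff one mult bij_betw_def inj_on_def image_restrict_eq)
    then show "?S \<noteq> {}" by blast
  next
    fix F assume "F \<in> ?S"
    then have F: "F \<in> hopf_automorphisms K A" and p: "\<And>x. x \<in> carrier A \<Longrightarrow> p (F x) = p x" by auto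
    note FD = hopf_automorphismsD[OF F]
    define G where "G = restrict (inv_into (carrier A) F) (carrier A)"
    have G_lin: "G \<in> linear_maps K A A"
      unfolding G_def by (intro linear_maps_restrict linear_maps_inv_into A FD)
    have GF: "G (F x) = x" if "x \<in> carrier A" for x
      unfolding G_def using that FD by (simp add: bij_betw_inv_into_left)
    have surj: "\<exists>x\<in>carrier A. y = F x" if "y \<in> carrier A" for y
      using FD(2) that unfolding bij_betw_def by blast
    have "G \<in> hopf_automorphisms K A"
      unfolding hopf_automorphisms_iff
    proof (intro conjI ballI G_lin)
      show "G \<in> extensional (carrier A)" by (simp add: G_def)
      show "bij_betw G (carrier A) (carrier A)"
        unfolding G_def using bij_betw_inv_into[OF FD(2)] by (simp cong: bij_betw_cong)
      show "G \<one>\<^bsub>A\<^esub> = \<one>\<^bsub>A\<^esub>" using GF[OF one] FD(6) by simp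
    next
      fix x y assume "x \<in> carrier A" "y \<in> carrier A"
      then obtain x' y' where xy: "x' \<in> carrier A" "x = F x'" "y' \<in> carrier A" "y = F y'"
        using surj by metis
      then show "G (x \<otimes>\<^bsub>A\<^esub> y) = G x \<otimes>\<^bsub>A\<^esub> G y"
        by (simp add: GF mult flip: FD(5))
    next
      fix x assume "x \<in> carrier A"
      then obtain x' where x: "x' \<in> carrier A" "x = F x'" using surj by metis
      show "counit A (G x) = counit A x" using x by (simp add: GF FD(8))
      have "tensor_sum (tensor_product K A A) (comult A x) (\<lambda>u v. tens K A A (G u) (G v)) =
          tensor_sum (tensor_product K A A) (comult A x') (\<lambda>u v. tens K A A (G (F u)) (G (F v)))"
        unfolding x(2) FD(7)[OF x(1)] by (rule tensor_map_compose[OF FD(3) G_lin comult[OF x(1)]])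
      also have "\<dots> = tensor_sum (tensor_product K A A) (comult A x') (tens K A A)"
        by (rule tensor_sum_cong[OF A A comult[OF x(1)]]) (simp add: GF)
      also have "\<dots> = comult A x'" by (rule tensor_sum_tens_self[OF A A comult[OF x(1)]])
      finally show "comult A (G x) = tensor_sum (tensor_product K A A) (comult A x)
        (\<lambda>u v. tens K A A (G u) (G v))"
        using x GF by simp
    qed
    moreover have "p (G x) = p x" if "x \<in> carrier A" for x
      using surj[OF that] p GF by auto
    moreover have "inv\<^bsub>BijGroup (carrier A)\<^esub> F = G"
      unfolding G_def using FD(1,2) by (intro inv_BijGroup) (simp add: Bij_def)
    ultimately show "inv\<^bsub>BijGroup (carrier A)\<^esub> F \<in> ?S" by simp
  next
    fix F G assume "F \<in> ?S" "G \<in> ?S"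
    then have F: "F \<in> hopf_automorphisms K A" and G: "G \<in> hopf_automorphisms K A"
      and p: "\<And>x. x \<in> carrier A \<Longrightarrow> p (F x) = p x" "\<And>x. x \<in> carrier A \<Longrightarrow> p (G x) = p x" by auto
    note FD = hopf_automorphismsD[OF F] and GD = hopf_automorphismsD[OF G]
    have "compose (carrier A) F G \<in> hopf_automorphisms K A"
      unfolding hopf_automorphisms_iff
    proof (intro conjI ballI)
      show "compose (carrier A) F G \<in> extensional (carrier A)" by (rule compose_extensional)
      show "bij_betw (compose (carrier A) F G) (carrier A) (carrier A)"
        by (rule bij_betw_compose[OF GD(2) FD(2)])
      show "compose (carrier A) F G \<in> linear_maps K A A"
        unfolding compose_def by (intro linear_maps_restrict A linear_maps_compose[OF FD(3) GD(3)])
      show "compose (carrier A) F G \<one>\<^bsub>A\<^esub> = \<one>\<^bsub>A\<^esub>" using one FD(6) GD(6) by (simp add: compose_def)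
    next
      fix x y assume "x \<in> carrier A" "y \<in> carrier A"
      then show "compose (carrier A) F G (x \<otimes>\<^bsub>A\<^esub> y) =
        compose (carrier A) F G x \<otimes>\<^bsub>A\<^esub> compose (carrier A) F G y"
        by (simp add: compose_def mult FD GD)
    next
      fix x assume x: "x \<in> carrier A"
      show "counit A (compose (carrier A) F G x) = counit A x" using x by (simp add: compose_def FD GD)
      have "comult A (F (G x)) =
          tensor_sum (tensor_product K A A) (comult A x) (\<lambda>u v. tens K A A (F (G u)) (F (G v)))"
        using x by (simp add: FD(7) GD(4,7) tensor_map_compose[OF GD(3) FD(3) comult])
      also have "\<dots> = tensor_sum (tensor_product K A A) (comult A x)
          (\<lambda>u v. tens K A A (compose (carrier A) F G u) (compose (carrier A) F G v))"
        by (rule tensor_sum_cong[OF A A comult[OF x]]) (simp add: compose_def)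
      finally show "comult A (compose (carrier A) F G x) =
        tensor_sum (tensor_product K A A) (comult A x)
          (\<lambda>u v. tens K A A (compose (carrier A) F G u) (compose (carrier A) F G v))"
        using x by (simp add: compose_def)
    qed
    moreover have "F \<otimes>\<^bsub>BijGroup (carrier A)\<^esub> G = compose (carrier A) F G"
      using FD(1,2) GD(1,2) by (simp add: BijGroup_def Bij_def)
    ultimately show "F \<otimes>\<^bsub>BijGroup (carrier A)\<^esub> G \<in> ?S"
      using p GD(4) by (simp add: compose_def)
  qed
  then show ?thesis by (rule subgroup.subgroup_is_group[OF _ group_BijGroup])
qed

section \<open>Dependence on the underlying vector space\<close>

text \<open>
  A biproduct is a record with more fields than the tensor product that carries it, so tensors over
  the one and over the other are formally different objects. They agree because the tensor relation
  only sees the vector space operations.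
\<close>

lemma tensor_rel_mono:
  assumes "(xs, ys) \<in> tensor_rel K V W"
    and "carrier V' = carrier V" "\<zero>\<^bsub>V'\<^esub> = \<zero>\<^bsub>V\<^esub>" "add V' = add V" "smult V' = smult V"
    and "carrier W' = carrier W" "add W' = add W" "smult W' = smult W"
  shows "(xs, ys) \<in> tensor_rel K V' W'"
  using assms(1)
proof (induction rule: tensor_rel.induct)
qed (auto simp flip: assms(2-) intro: tensor_rel.intros)

lemma list_sum_reduct:
  assumes "add U = add U'" "\<zero>\<^bsub>U\<^esub> = \<zero>\<^bsub>U'\<^esub>"
  shows "list_sum U f xs = list_sum U' f xs"
  by (induction xs) (auto simp: assms)

lemma tensor_sum_reduct:
  assumes "add U = add U'" "\<zero>\<^bsub>U\<^esub> = \<zero>\<^bsub>U'\<^esub>"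
  shows "tensor_sum U = tensor_sum U'"
  unfolding tensor_sum_def using list_sum_reduct[OF assms] by metis

lemma biproduct_fields:
  "carrier (biproduct K H B act coact) = carrier (tensor_product K B H)"
  "mult (biproduct K H B act coact) = (\<lambda>x y. tensor_sum (tensor_product K B H) x (\<lambda>b h.
    tensor_sum (tensor_product K B H) y (\<lambda>b' h'. tensor_sum (tensor_product K B H) (comult H h) (\<lambda>h1 h2.
      tens K B H (b \<otimes>\<^bsub>B\<^esub> act h1 b') (h2 \<otimes>\<^bsub>H\<^esub> h')))))"
  "one (biproduct K H B act coact) = tens K B H \<one>\<^bsub>B\<^esub> \<one>\<^bsub>H\<^esub>"
  "zero (biproduct K H B act coact) = \<zero>\<^bsub>tensor_product K B H\<^esub>"
  "add (biproduct K H B act coact) = add (tensor_product K B H)"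
  "smult (biproduct K H B act coact) = smult (tensor_product K B H)"
  by (simp_all add: biproduct_def)

lemma biproduct_coalgebra_fields:
  assumes "V = tensor_product K B H"
  shows "comult (biproduct K H B act coact) = (\<lambda>x. tensor_sum (tensor_product K V V) x (\<lambda>b h.
       tensor_sum (tensor_product K V V) (comult B b)
         (\<lambda>b1 b2. tensor_sum (tensor_product K V V) (coact b2) (\<lambda>y c.
     tensor_sum (tensor_product K V V) (comult H h) (\<lambda>h1 h2.
       tens K V V (tens K B H b1 (y \<otimes>\<^bsub>H\<^esub> h1)) (tens K B H c h2))))))"
    and "counit (biproduct K H B act coact) = (\<lambda>x. tensor_sum K x (\<lambda>b h. counit B b \<otimes>\<^bsub>K\<^esub> counit H h))"
  by (simp_all add: biproduct_def assms)

lemma tensor_product_fields: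
  "carrier (tensor_product K V W) = lists (carrier V \<times> carrier W) // tensor_rel K V W"
  "add (tensor_product K V W) = (\<lambda>s t. \<Union>xs\<in>s. \<Union>ys\<in>t. tensor_rel K V W `` {xs @ ys})"
  "\<zero>\<^bsub>tensor_product K V W\<^esub> = tensor_rel K V W `` {[]}"
  by (simp_all add: tensor_product_def)

lemma one_tensor_product: "\<one>\<^bsub>tensor_product K V W\<^esub> = tens K V W \<one>\<^bsub>V\<^esub> \<one>\<^bsub>W\<^esub>"
  by (simp add: tensor_product_def)

lemma module_reduct:
  assumes "module K V"
    and "carrier V' = carrier V" "\<zero>\<^bsub>V'\<^esub> = \<zero>\<^bsub>V\<^esub>" "add V' = add V" "smult V' = smult V"
  shows "module K V'"
proof -
  interpret V: module K V by fact
  show ?thesis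
  proof (rule moduleI)
    show "cring K" ..
    show "abelian_group V'"
    proof (rule abelian_groupI)
      show "\<exists>y\<in>carrier V'. y \<oplus>\<^bsub>V'\<^esub> x = \<zero>\<^bsub>V'\<^esub>" if "x \<in> carrier V'" for x
        using that V.l_neg V.a_inv_closed unfolding assms(2-) by blast
    qed (simp_all add: assms(2-) V.a_ac)
  qed (simp_all add: assms(2-) V.smult_l_distr V.smult_r_distr V.smult_assoc1)
qed

section \<open>Structure maps of a biproduct\<close>

context biproduct_datum
begin

abbreviation V where "V \<equiv> tensor_product K B H"
abbreviation VV where "VV \<equiv> tensor_product K V V"
abbreviation A where "A \<equiv> biproduct K H B act coact"
abbreviation cross (infixl "\<sharp>" 75) where "b \<sharp> h \<equiv> tens K B H b h"
abbreviation to_B where "to_B \<equiv> proj_B H B"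
abbreviation to_H where "to_H \<equiv> proj_H H B"

lemma K_cring: "cring K" ..

lemma modules: "module K H" "module K B" "module K V" "module K VV" "module K (base_module K)"
    "module K (tensor_product K H H)" "module K (tensor_product K B B)"
      "module K (tensor_product K H B)"
proof -
  show "module K H" and "module K B" by unfold_locales
  then show "module K V" "module K VV" "module K (tensor_product K H H)"
    "module K (tensor_product K B B)" "module K (tensor_product K H B)"
    by (simp_all add: tensor_product_module)
qed (rule base_module_module[OF K_cring])

lemma algebras: "unital_algebra K H" "unital_algebra K B"
  by unfold_locales

lemma coalgebras: "coalgebra K H" "coalgebra K B"
  by unfold_locales

lemmas comult_linears = coalgebras[THEN coalgebra.comult_linear]
lemmas counit_linears = coalgebras[THEN coalgebra.counit_linear]

lemma comult_H_closed: "h \<in> carrier H \<Longrightarrow> comult H h \<in> carrier (tensor_product K H H)"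
  and comult_B_closed: "b \<in> carrier B \<Longrightarrow> comult B b \<in> carrier (tensor_product K B B)"
  and coact_closed: "b \<in> carrier B \<Longrightarrow> coact b \<in> carrier (tensor_product K H B)"
  and act_closed: "\<lbrakk>h \<in> carrier H; b \<in> carrier B\<rbrakk> \<Longrightarrow> act h b \<in> carrier B"
  and mult_H_closed: "\<lbrakk>h \<in> carrier H; h' \<in> carrier H\<rbrakk> \<Longrightarrow> h \<otimes>\<^bsub>H\<^esub> h' \<in> carrier H"
  and mult_B_closed: "\<lbrakk>b \<in> carrier B; b' \<in> carrier B\<rbrakk> \<Longrightarrow> b \<otimes>\<^bsub>B\<^esub> b' \<in> carrier B"
  and smult_H_closed: "\<lbrakk>c \<in> carrier K; h \<in> carrier H\<rbrakk> \<Longrightarrow> c \<odot>\<^bsub>H\<^esub> h \<in> carrier H"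
  and smult_B_closed: "\<lbrakk>c \<in> carrier K; b \<in> carrier B\<rbrakk> \<Longrightarrow> c \<odot>\<^bsub>B\<^esub> b \<in> carrier B"
  and cross_closed: "\<lbrakk>b \<in> carrier B; h \<in> carrier H\<rbrakk> \<Longrightarrow> b \<sharp> h \<in> carrier V"
  and tens_V_closed: "\<lbrakk>x \<in> carrier V; y \<in> carrier V\<rbrakk> \<Longrightarrow> tens K V V x y \<in> carrier VV"
  and one_H_closed: "\<one>\<^bsub>H\<^esub> \<in> carrier H" and one_B_closed: "\<one>\<^bsub>B\<^esub> \<in> carrier B"
  and counit_H_closed: "h \<in> carrier H \<Longrightarrow> counit H h \<in> carrier K"
  and counit_B_closed: "b \<in> carrier B \<Longrightarrow> counit B b \<in> carrier K"
  using modules comult_linears[THEN linear_mapsD(1)] counit_linears[THEN linear_mapsD(1)]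
    linear_mapsD(1)[OF coact_linear] bilinear_mapsD(3)[OF act_bilinear] algebras
  by (auto intro: tens_closed module.smult_closed dest: unital_algebra.axioms(3)
      simp: base_module_def ring.ring_simprules)

lemmas closed = comult_H_closed comult_B_closed coact_closed act_closed mult_H_closed mult_B_closed
  smult_H_closed smult_B_closed cross_closed tens_V_closed one_H_closed one_B_closed
  counit_H_closed counit_B_closed

lemma smult_cross:
  assumes "c \<in> carrier K" "b \<in> carrier B" "h \<in> carrier H"
  shows "(c \<odot>\<^bsub>B\<^esub> b) \<sharp> h = b \<sharp> (c \<odot>\<^bsub>H\<^esub> h)"
  using linear_mapsD(3)[OF bilinear_mapsD(1)[OF tens_bilinear[OF modules(2,1)]]]
    linear_mapsD(3)[OF bilinear_mapsD(2)[OF tens_bilinear[OF modules(2,1)]]] assms by simp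

lemma linear_maps_base_mult_left:
  assumes "f \<in> linear_maps K X (base_module K)" "c \<in> carrier K"
  shows "(\<lambda>x. f x \<otimes>\<^bsub>K\<^esub> c) \<in> linear_maps K X (base_module K)"
  using linear_maps_smult_left[OF assms(1) _ modules(5), of c] assms(2) by (simp add: base_module_def)

lemma linear_maps_base_mult_right:
  assumes "f \<in> linear_maps K X (base_module K)" "c \<in> carrier K"
  shows "(\<lambda>x. c \<otimes>\<^bsub>K\<^esub> f x) \<in> linear_maps K X (base_module K)"
  using linear_maps_smult_right[OF assms modules(5)] by (simp add: base_module_def)

text \<open>
  Together these rules prove bilinearity of every expression that is built below from the structure
  maps. They have to be tried on the first goal only, since the first premise of each rule
  determines the spaces that occur in the later ones.
\<close>

lemmas multilinear = bilinear_mapsI linear_maps_id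
  linear_maps_tens_left linear_maps_tens_right
  linear_maps_tensor_sum_left linear_maps_tensor_sum_right
  linear_maps_smult_left linear_maps_smult_right linear_maps_base_mult_left linear_maps_base_mult_right
  linear_maps_mult_left linear_maps_mult_right
  comult_linears[THEN linear_maps_compose] counit_linears[THEN linear_maps_compose]
  coact_linear[THEN linear_maps_compose]
  act_bilinear[THEN bilinear_mapsD(1), THEN linear_maps_compose]
  act_bilinear[THEN bilinear_mapsD(2), THEN linear_maps_compose]
  modules algebras closed

abbreviation mult_summand where
  "mult_summand b h b' h' \<equiv> tensor_sum V (comult H h) (\<lambda>h1 h2. (b \<otimes>\<^bsub>B\<^esub> act h1 b') \<sharp> (h2 \<otimes>\<^bsub>H\<^esub> h'))"

lemma mult_summand_bilinear:
  assumes "b \<in> carrier B" "h \<in> carrier H"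
  shows "mult_summand b h \<in> bilinear_maps K B H V"
  using assms by - (rule multilinear | assumption)+

lemma mult_right_sum_bilinear: "y \<in> carrier V \<Longrightarrow> (\<lambda>b h. tensor_sum V y (mult_summand b h)) \<in>
  bilinear_maps K B H V"
  by (rule multilinear | assumption)+

lemma mult_sum_bilinear: "(\<lambda>x y. tensor_sum V x (\<lambda>b h. tensor_sum V y (mult_summand b h))) \<in>
  bilinear_maps K V V V"
  by (rule multilinear | assumption)+

abbreviation comult_summand where
  "comult_summand b h \<equiv> tensor_sum VV (comult B b) (\<lambda>b1 b2. tensor_sum VV (coact b2) (\<lambda>y c.
     tensor_sum VV (comult H h) (\<lambda>h1 h2. tens K V V (b1 \<sharp> (y \<otimes>\<^bsub>H\<^esub> h1)) (c \<sharp> h2))))"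

lemma comult_summand_bilinear: "comult_summand \<in> bilinear_maps K B H VV"
  by (rule multilinear | assumption)+

lemma proj_B_summand_bilinear: "(\<lambda>b h. counit H h \<odot>\<^bsub>B\<^esub> b) \<in> bilinear_maps K B H B"
  by (rule multilinear | assumption)+

lemma proj_H_summand_bilinear: "(\<lambda>b h. counit B b \<odot>\<^bsub>H\<^esub> h) \<in> bilinear_maps K B H H"
  by (rule multilinear | assumption)+

lemma counit_summand_bilinear: "(\<lambda>b h. counit B b \<otimes>\<^bsub>K\<^esub> counit H h) \<in> bilinear_maps K B H
  (base_module K)"
  by (rule multilinear | assumption)+

lemmas biproduct_reduct = biproduct_fields(1,4,5,6)[of K H B act coact]

lemma tensor_rel_biproduct: "tensor_rel K A A = tensor_rel K V V"
proof (intro equalityI subrelI)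
  fix xs ys
  show "(xs, ys) \<in> tensor_rel K V V" if "(xs, ys) \<in> tensor_rel K A A"
    by (rule tensor_rel_mono[OF that]) (simp_all only: biproduct_reduct)
  show "(xs, ys) \<in> tensor_rel K A A" if "(xs, ys) \<in> tensor_rel K V V"
    by (rule tensor_rel_mono[OF that]) (simp_all only: biproduct_reduct)
qed

lemma tens_biproduct: "tens K A A = tens K V V"
  unfolding tens_def[abs_def] tensor_rel_biproduct ..

lemma tensor_product_biproduct:
  "carrier (tensor_product K A A) = carrier VV" "tensor_sum (tensor_product K A A) = tensor_sum VV"
  "tensor_sum A = tensor_sum V"
proof -
  show "carrier (tensor_product K A A) = carrier VV"
    by (simp only: tensor_product_fields(1)[of K A A] tensor_product_fields(1)[of K V V]
        tensor_rel_biproduct biproduct_reduct)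
  show "tensor_sum (tensor_product K A A) = tensor_sum VV"
    by (rule tensor_sum_reduct) (simp_all only: tensor_product_fields(2,3)[of K A A]
        tensor_product_fields(2,3)[of K V V] tensor_rel_biproduct)
  show "tensor_sum A = tensor_sum V"
    by (rule tensor_sum_reduct) (simp_all only: biproduct_reduct)
qed

lemma linear_maps_biproduct: "linear_maps K A A = linear_maps K V V"
  by (simp only: linear_maps_def biproduct_reduct)

lemma tensor_sum_base: "tensor_sum K = tensor_sum (base_module K)"
  by (rule tensor_sum_reduct) (simp_all add: base_module_def)

lemma module_biproduct: "module K A"
  by (rule module_reduct[OF modules(3)]) (simp_all only: biproduct_reduct)

lemma biproduct_mult_bilinear: "(\<lambda>x y. x \<otimes>\<^bsub>A\<^esub> y) \<in> bilinear_maps K V V V"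
  unfolding biproduct_fields by (rule mult_sum_bilinear)

lemma biproduct_mult:
  assumes "b \<in> carrier B" "h \<in> carrier H" "b' \<in> carrier B" "h' \<in> carrier H"
  shows "(b \<sharp> h) \<otimes>\<^bsub>A\<^esub> (b' \<sharp> h') = mult_summand b h b' h'"
  unfolding biproduct_fields
  by (rule HOL.trans[OF tensor_sum_tens[OF modules(2,1,3)
    mult_right_sum_bilinear[OF cross_closed[OF assms(3,4)]] assms(1,2)]
      tensor_sum_tens[OF modules(2,1,3) mult_summand_bilinear[OF assms(1,2)] assms(3,4)]])

lemma biproduct_comult_linear: "comult A \<in> linear_maps K V VV"
  unfolding biproduct_coalgebra_fields[OF HOL.refl]
    by (rule tensor_sum_linear[OF modules(2,1,4) comult_summand_bilinear])

lemma biproduct_comult: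
  assumes "b \<in> carrier B" "h \<in> carrier H"
  shows "comult A (b \<sharp> h) = comult_summand b h"
  unfolding biproduct_coalgebra_fields[OF HOL.refl]
    by (rule tensor_sum_tens[OF modules(2,1,4) comult_summand_bilinear assms])

lemma biproduct_counit_linear: "counit A \<in> linear_maps K V (base_module K)"
  unfolding biproduct_coalgebra_fields[OF HOL.refl] tensor_sum_base
  by (rule tensor_sum_linear[OF modules(2,1,5) counit_summand_bilinear])

lemma biproduct_counit:
  assumes "b \<in> carrier B" "h \<in> carrier H"
  shows "counit A (b \<sharp> h) = counit B b \<otimes>\<^bsub>K\<^esub> counit H h"
  unfolding biproduct_coalgebra_fields[OF HOL.refl] tensor_sum_base
  by (rule tensor_sum_tens[OF modules(2,1,5) counit_summand_bilinear assms])

lemma to_B_linear: "to_B \<in> linear_maps K V B"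
  using tensor_sum_linear[OF modules(2,1,2) proj_B_summand_bilinear] unfolding proj_B_def[abs_def] .

lemma to_H_linear: "to_H \<in> linear_maps K V H"
  using tensor_sum_linear[OF modules(2,1,1) proj_H_summand_bilinear] unfolding proj_H_def[abs_def] .

lemma to_B_cross: "\<lbrakk>b \<in> carrier B; h \<in> carrier H\<rbrakk> \<Longrightarrow> to_B (b \<sharp> h) = counit H h \<odot>\<^bsub>B\<^esub> b"
  unfolding proj_B_def by (rule tensor_sum_tens[OF modules(2,1,2) proj_B_summand_bilinear])

lemma to_H_cross: "\<lbrakk>b \<in> carrier B; h \<in> carrier H\<rbrakk> \<Longrightarrow> to_H (b \<sharp> h) = counit B b \<odot>\<^bsub>H\<^esub> h"
  unfolding proj_H_def by (rule tensor_sum_tens[OF modules(2,1,1) proj_H_summand_bilinear])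

lemma counit_one: "counit H \<one>\<^bsub>H\<^esub> = \<one>\<^bsub>K\<^esub>" "counit B \<one>\<^bsub>B\<^esub> = \<one>\<^bsub>K\<^esub>"
  by (rule ring_hom_one[OF counit_hom], rule ring_hom_one[OF counit_algebra_map])

lemma comult_H_one: "comult H \<one>\<^bsub>H\<^esub> = tens K H H \<one>\<^bsub>H\<^esub> \<one>\<^bsub>H\<^esub>"
  using ring_hom_one[OF comult_hom] by (simp only: one_tensor_product)

lemma cross_one_mult:
  assumes "b \<in> carrier B" "b' \<in> carrier B" "h \<in> carrier H"
  shows "(b \<sharp> \<one>\<^bsub>H\<^esub>) \<otimes>\<^bsub>A\<^esub> (b' \<sharp> h) = (b \<otimes>\<^bsub>B\<^esub> b') \<sharp> h"
proof -
  have bil: "(\<lambda>h1 h2. (b \<otimes>\<^bsub>B\<^esub> act h1 b') \<sharp> (h2 \<otimes>\<^bsub>H\<^esub> h)) \<in> bilinear_maps K H H V"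
    using assms by - (rule multilinear | assumption)+
  show ?thesis
    using assms by (simp add: biproduct_mult closed comult_H_one
      tensor_sum_tens[OF modules(1,1,3) bil] act_one)
qed

text \<open>
  The second tensor factor of
  \<open>\<Delta>(b \<times> h) = (b\<^sub>(\<^sub>1\<^sub>) \<times> b\<^sub>(\<^sub>2\<^sub>)\<^sub>(\<^sub>-\<^sub>1\<^sub>) h\<^sub>(\<^sub>1\<^sub>)) \<otimes> (b\<^sub>(\<^sub>2\<^sub>)\<^sub>(\<^sub>0\<^sub>) \<times> h\<^sub>(\<^sub>2\<^sub>))\<close> is projected to \<open>H\<close>,
  which puts a counit on \<open>b\<^sub>(\<^sub>2\<^sub>)\<^sub>(\<^sub>0\<^sub>)\<close>. The comodule coalgebra law \<open>b\<^sub>(\<^sub>-\<^sub>1\<^sub>) \<epsilon>(b\<^sub>(\<^sub>0\<^sub>)) = \<epsilon>(b) 1\<close>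
  then removes the coaction, and the counit law of \<open>B\<close> removes the comultiplication of \<open>b\<close>.
\<close>

lemma comult_cross_collapse:
  assumes p: "p \<in> linear_maps K V B" and b: "b \<in> carrier B" and h: "h \<in> carrier H"
  shows "tensor_sum V (comult A (b \<sharp> h)) (\<lambda>u v. p u \<sharp> to_H v) =
    tensor_sum V (comult H h) (\<lambda>h1 h2. p (b \<sharp> h1) \<sharp> h2)"
proof -
  note M = modules(1-4)
  note pc = linear_mapsD(1)[OF p]
  note pp = p[THEN linear_maps_compose]
  \<comment> \<open>the sum as a bilinear function of the two slots that \<open>b\<^sub>(\<^sub>1\<^sub>)\<close> and \<open>b\<^sub>(\<^sub>2\<^sub>)\<^sub>(\<^sub>-\<^sub>1\<^sub>)\<close> fill;
     the scalar \<open>\<epsilon>(b\<^sub>(\<^sub>2\<^sub>)\<^sub>(\<^sub>0\<^sub>))\<close> can then be moved between the slots\<close>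
  define \<Psi> where "\<Psi> = (\<lambda>b y. tensor_sum V (comult H h) (\<lambda>h1 h2. p (b \<sharp> (y \<otimes>\<^bsub>H\<^esub> h1)) \<sharp> h2))"
  have \<Psi>: "\<Psi> \<in> bilinear_maps K B H V"
    unfolding \<Psi>_def using h by - (rule multilinear pp pc | assumption)+
  have G: "(\<lambda>u v. p u \<sharp> to_H v) \<in> bilinear_maps K V V V"
    by (rule tensor_map_bilinear[OF M(2,1) p to_H_linear])
  have scal: "tensor_sum V (comult H h) (\<lambda>h1 h2. p (b1 \<sharp> (y \<otimes>\<^bsub>H\<^esub> h1)) \<sharp> to_H (c \<sharp> h2)) =
    \<Psi> b1 (counit B c \<odot>\<^bsub>H\<^esub> y)"
    if "b1 \<in> carrier B" "y \<in> carrier H" "c \<in> carrier B" for b1 y c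
  proof -
    have "p (b1 \<sharp> (y \<otimes>\<^bsub>H\<^esub> h1)) \<sharp> to_H (c \<sharp> h2) = p (b1 \<sharp> ((counit B c \<odot>\<^bsub>H\<^esub> y) \<otimes>\<^bsub>H\<^esub> h1)) \<sharp> h2"
      if "h1 \<in> carrier H" "h2 \<in> carrier H" for h1 h2
    proof -
      have "p (b1 \<sharp> ((counit B c \<odot>\<^bsub>H\<^esub> y) \<otimes>\<^bsub>H\<^esub> h1)) = counit B c \<odot>\<^bsub>B\<^esub> p (b1 \<sharp> (y \<otimes>\<^bsub>H\<^esub> h1))"
        using \<open>b1 \<in> _\<close> \<open>y \<in> _\<close> \<open>c \<in> _\<close> that
        by (simp add: unital_algebra.smult_mult_left[OF algebras(1)] closed linear_mapsD(3)[OF p]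
          linear_mapsD(3)[OF bilinear_mapsD(1)[OF tens_bilinear[OF M(2,1)]]])
      then show ?thesis
        using \<open>b1 \<in> _\<close> \<open>y \<in> _\<close> \<open>c \<in> _\<close> that by (simp add: to_H_cross smult_cross closed pc)
    qed
    then show ?thesis
      unfolding \<Psi>_def using h by (intro tensor_sum_cong[OF M(1,1)] closed)
  qed
  have "tensor_sum V (comult A (b \<sharp> h)) (\<lambda>u v. p u \<sharp> to_H v) =
    tensor_sum V (comult B b) (\<lambda>b1 b2. tensor_sum V (tensor_sum VV (coact b2) (\<lambda>y c.
     tensor_sum VV (comult H h) (\<lambda>h1 h2. tens K V V (b1 \<sharp> (y \<otimes>\<^bsub>H\<^esub> h1)) (c \<sharp> h2))))
       (\<lambda>u v. p u \<sharp> to_H v))"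
    unfolding biproduct_comult[OF b h] using b h
    by (intro tensor_sum_tensor_sum[OF M(2,2,3,3,3) G] closed tensor_sum_closed[OF M(1,2,4)]
      tensor_sum_closed[OF M(1,1,4)])
  also have "\<dots> = tensor_sum V (comult B b) (\<lambda>b1 b2. tensor_sum V (coact b2) (\<lambda>y c.
     tensor_sum V (tensor_sum VV (comult H h) (\<lambda>h1 h2. tens K V V (b1 \<sharp> (y \<otimes>\<^bsub>H\<^esub> h1)) (c \<sharp> h2)))
       (\<lambda>u v. p u \<sharp> to_H v)))"
    using b h
    by (intro tensor_sum_cong[OF M(2,2)] tensor_sum_tensor_sum[OF M(1,2,3,3,3) G] closed
      tensor_sum_closed[OF M(1,1,4)])
  also have "\<dots> = tensor_sum V (comult B b) (\<lambda>b1 b2. tensor_sum V (coact b2) (\<lambda>y c.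
     tensor_sum V (comult H h) (\<lambda>h1 h2. p (b1 \<sharp> (y \<otimes>\<^bsub>H\<^esub> h1)) \<sharp> to_H (c \<sharp> h2))))"
  proof (intro tensor_sum_cong[OF M(2,2)] tensor_sum_cong[OF M(1,2)] closed b)
    fix b1 b2 y c assume "b1 \<in> carrier B" "b2 \<in> carrier B" "y \<in> carrier H" "c \<in> carrier B"
    then show "tensor_sum V (tensor_sum VV (comult H h)
      (\<lambda>h1 h2. tens K V V (b1 \<sharp> (y \<otimes>\<^bsub>H\<^esub> h1)) (c \<sharp> h2))) (\<lambda>u v. p u \<sharp> to_H v) =
      tensor_sum V (comult H h) (\<lambda>h1 h2. p (b1 \<sharp> (y \<otimes>\<^bsub>H\<^esub> h1)) \<sharp> to_H (c \<sharp> h2))"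
      using h
      by (intro HOL.trans[OF tensor_sum_tensor_sum[OF M(1,1,3,3,3) G]] tensor_sum_cong[OF M(1,1)]
          tensor_sum_tens[OF M(3,3,3) G] closed)
  qed
  also have "\<dots> = tensor_sum V (comult B b)
    (\<lambda>b1 b2. tensor_sum V (coact b2) (\<lambda>y c. \<Psi> b1 (counit B c \<odot>\<^bsub>H\<^esub> y)))"
    by (intro tensor_sum_cong[OF M(2,2)] tensor_sum_cong[OF M(1,2)] closed b scal)
  also have "\<dots> = tensor_sum V (comult B b) (\<lambda>b1 b2. \<Psi> (counit B b2 \<odot>\<^bsub>B\<^esub> b1) \<one>\<^bsub>H\<^esub>)"
  proof (intro tensor_sum_cong[OF M(2,2)] closed b)
    fix b1 b2 assume b12: "b1 \<in> carrier B" "b2 \<in> carrier B"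
    have "tensor_sum V (coact b2) (\<lambda>y c. \<Psi> b1 (counit B c \<odot>\<^bsub>H\<^esub> y)) =
      \<Psi> b1 (tensor_sum H (coact b2) (\<lambda>y c. counit B c \<odot>\<^bsub>H\<^esub> y))"
      using b12 by (intro linear_map_tensor_sum[OF M(1,2,1,3), symmetric] bilinear_mapsD(1)[OF \<Psi>]
        closed)
    also have "\<dots> = \<Psi> (counit B b2 \<odot>\<^bsub>B\<^esub> b1) \<one>\<^bsub>H\<^esub>"
      using b12 by (simp add: comodule_coalgebra_counit closed
        linear_mapsD(3)[OF bilinear_mapsD(1)[OF \<Psi>]]
        linear_mapsD(3)[OF bilinear_mapsD(2)[OF \<Psi>]])
    finally show "tensor_sum V (coact b2) (\<lambda>y c. \<Psi> b1 (counit B c \<odot>\<^bsub>H\<^esub> y)) =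
      \<Psi> (counit B b2 \<odot>\<^bsub>B\<^esub> b1) \<one>\<^bsub>H\<^esub>" .
  qed
  also have "\<dots> = \<Psi> (tensor_sum B (comult B b) (\<lambda>b1 b2. counit B b2 \<odot>\<^bsub>B\<^esub> b1)) \<one>\<^bsub>H\<^esub>"
    by (rule linear_map_tensor_sum[OF M(2,2,2,3) bilinear_mapsD(2)[OF \<Psi>], symmetric])
      (simp_all add: closed b)
  also have "\<dots> = \<Psi> b \<one>\<^bsub>H\<^esub>"
    by (simp add: coalgebra.counit_right[OF coalgebras(2) b])
  also have "\<dots> = tensor_sum V (comult H h) (\<lambda>h1 h2. p (b \<sharp> h1) \<sharp> h2)"
    unfolding \<Psi>_def by (rule tensor_sum_cong[OF M(1,1)]) (simp_all add: closed h)
  finally show ?thesis .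
qed

lemma counit_collapse:
  assumes b: "b \<in> carrier B" and h: "h \<in> carrier H"
  shows "tensor_sum V (comult H h) (\<lambda>h1 h2. (counit H h1 \<odot>\<^bsub>B\<^esub> b) \<sharp> h2) = b \<sharp> h"
proof -
  have "tensor_sum V (comult H h) (\<lambda>h1 h2. (counit H h1 \<odot>\<^bsub>B\<^esub> b) \<sharp> h2) =
     tensor_sum V (comult H h) (\<lambda>h1 h2. b \<sharp> (counit H h1 \<odot>\<^bsub>H\<^esub> h2))"
    using b by (intro tensor_sum_cong[OF modules(1,1)] closed h) (simp add: smult_cross closed)
  also have "\<dots> = b \<sharp> tensor_sum H (comult H h) (\<lambda>h1 h2. counit H h1 \<odot>\<^bsub>H\<^esub> h2)"
    by (intro linear_map_tensor_sum[OF modules(1,1,1,3), symmetric] closed h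
       bilinear_mapsD(1)[OF tens_bilinear[OF modules(2,1)] b])
  also have "\<dots> = b \<sharp> h" by (simp add: coalgebra.counit_left[OF coalgebras(1) h])
  finally show ?thesis .
qed

text \<open>
  An element of the biproduct can be recovered from the two projections:
  \<open>x = \<Pi>(x\<^sub>(\<^sub>1\<^sub>)) \<times> \<pi>(x\<^sub>(\<^sub>2\<^sub>))\<close>.
\<close>

lemma comult_reconstruct:
  assumes x: "x \<in> carrier V"
  shows "tensor_sum V (comult A x) (\<lambda>u v. to_B u \<sharp> to_H v) = x"
proof (rule linear_maps_tensor_eqI[OF modules(2,1,3) _ linear_maps_id _ x])
  show "(\<lambda>x. tensor_sum V (comult A x) (\<lambda>u v. to_B u \<sharp> to_H v)) \<in> linear_maps K V V"
    by (rule linear_maps_compose[OF tensor_sum_linear[OF modules(3,3,3)] biproduct_comult_linear])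
      (rule tensor_map_bilinear[OF modules(2,1) to_B_linear to_H_linear])
next
  fix b h assume b: "b \<in> carrier B" and h: "h \<in> carrier H"
  have "tensor_sum V (comult A (b \<sharp> h)) (\<lambda>u v. to_B u \<sharp> to_H v) =
      tensor_sum V (comult H h) (\<lambda>h1 h2. to_B (b \<sharp> h1) \<sharp> h2)"
    by (rule comult_cross_collapse[OF to_B_linear b h])
  also have "\<dots> = tensor_sum V (comult H h) (\<lambda>h1 h2. (counit H h1 \<odot>\<^bsub>B\<^esub> b) \<sharp> h2)"
    by (intro tensor_sum_cong[OF modules(1,1)] closed h) (simp only: to_B_cross b)
  also have "\<dots> = b \<sharp> h" by (rule counit_collapse[OF b h])
  finally show "tensor_sum V (comult A (b \<sharp> h)) (\<lambda>u v. to_B u \<sharp> to_H v) = b \<sharp> h" .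
qed

section \<open>Automorphisms over the projection to H\<close>

abbreviation G where "G \<equiv> Aut_Hopf_pi K H B act coact"
abbreviation YD where "YD \<equiv> Aut_YD_Hopf K H B act coact"
abbreviation \<Phi> where "\<Phi> \<equiv> Phi_YD K H B act coact"
abbreviation L where "L \<equiv> left_part K H B"
abbreviation R where "R \<equiv> right_part K H B"

lemma biproduct_map_eqI:
  assumes "F \<in> extensional (carrier V)" "F' \<in> extensional (carrier V)"
    and "F \<in> linear_maps K V V" "F' \<in> linear_maps K V V"
    and "\<And>b h. \<lbrakk>b \<in> carrier B; h \<in> carrier H\<rbrakk> \<Longrightarrow> F (b \<sharp> h) = F' (b \<sharp> h)"
  shows "F = F'"
  by (rule extensionalityI[OF assms(1,2) linear_maps_tensor_eqI[OF modules(2,1,3) assms(3,4,5)]])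

lemma Aut_Hopf_pi_iff:
  "F \<in> carrier G \<longleftrightarrow>
    F \<in> extensional (carrier V) \<and> bij_betw F (carrier V) (carrier V) \<and> F \<in> linear_maps K V V \<and>
    (\<forall>x\<in>carrier V. \<forall>y\<in>carrier V. F (x \<otimes>\<^bsub>A\<^esub> y) = F x \<otimes>\<^bsub>A\<^esub> F y) \<and> F (\<one>\<^bsub>B\<^esub> \<sharp> \<one>\<^bsub>H\<^esub>) = \<one>\<^bsub>B\<^esub> \<sharp> \<one>\<^bsub>H\<^esub> \<and>
    (\<forall>x\<in>carrier V. comult A (F x) =
      tensor_sum VV (comult A x) (\<lambda>u v. tens K V V (F u) (F v))) \<and>
    (\<forall>x\<in>carrier V. counit A (F x) = counit A x) \<and> (\<forall>x\<in>carrier V. to_H (F x) = to_H x)"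
proof -
  have "carrier G = {F \<in> hopf_automorphisms K A. \<forall>x\<in>carrier A. to_H (F x) = to_H x}"
    by (simp add: Aut_Hopf_pi_def)
  then show ?thesis
    by (simp only: hopf_automorphisms_iff mem_Collect_eq biproduct_fields(1,3) tens_biproduct
      tensor_product_biproduct linear_maps_biproduct conj_assoc)
qed

lemma Aut_Hopf_piD:
  assumes "F \<in> carrier G"
  shows "F \<in> extensional (carrier V)" "bij_betw F (carrier V) (carrier V)" "F \<in> linear_maps K V V"
    and "\<And>x. x \<in> carrier V \<Longrightarrow> F x \<in> carrier V"
    and "\<And>x y. \<lbrakk>x \<in> carrier V; y \<in> carrier V\<rbrakk> \<Longrightarrow> F (x \<otimes>\<^bsub>A\<^esub> y) = F x \<otimes>\<^bsub>A\<^esub> F y"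
    and "F (\<one>\<^bsub>B\<^esub> \<sharp> \<one>\<^bsub>H\<^esub>) = \<one>\<^bsub>B\<^esub> \<sharp> \<one>\<^bsub>H\<^esub>"
    and "\<And>x. x \<in> carrier V \<Longrightarrow> comult A (F x) =
      tensor_sum VV (comult A x) (\<lambda>u v. tens K V V (F u) (F v))"
    and "\<And>x. x \<in> carrier V \<Longrightarrow> to_H (F x) = to_H x"
  using assms[unfolded Aut_Hopf_pi_iff] linear_mapsD(1)[of F K V V] by blast+

lemma group_Aut_Hopf_pi: "group G"
  unfolding Aut_Hopf_pi_def
proof (rule group_hopf_automorphisms_over[OF module_biproduct]; unfold biproduct_fields(1)
  tensor_product_biproduct(1))
  show "\<one>\<^bsub>A\<^esub> \<in> carrier V" unfolding biproduct_fields by (intro closed)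
  show "x \<otimes>\<^bsub>A\<^esub> y \<in> carrier V" if "x \<in> carrier V" "y \<in> carrier V" for x y
    using bilinear_mapsD(3)[OF biproduct_mult_bilinear that] .
  show "comult A x \<in> carrier VV" if "x \<in> carrier V" for x
    by (rule linear_mapsD(1)[OF biproduct_comult_linear that])
qed

lemma Aut_Hopf_pi_mult: "\<lbrakk>F \<in> carrier G; F' \<in> carrier G\<rbrakk> \<Longrightarrow> F \<otimes>\<^bsub>G\<^esub> F' = compose (carrier V) F F'"
  using Aut_Hopf_piD(1,2)[of F] Aut_Hopf_piD(1,2)[of F']
  by (simp add: Aut_Hopf_pi_def BijGroup_def Bij_def biproduct_fields(1))

lemma Aut_Hopf_pi_one: "\<one>\<^bsub>G\<^esub> = (\<lambda>x\<in>carrier V. x)"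
  by (simp add: Aut_Hopf_pi_def BijGroup_def biproduct_fields(1))

lemma left_part_eq: "b \<in> carrier B \<Longrightarrow> L F b = to_B (F (b \<sharp> \<one>\<^bsub>H\<^esub>))"
  and right_part_eq: "h \<in> carrier H \<Longrightarrow> R F h = to_B (F (\<one>\<^bsub>B\<^esub> \<sharp> h))"
  and left_part_extensional: "L F \<in> extensional (carrier B)"
  and right_part_extensional: "R F \<in> extensional (carrier H)"
  by (simp_all add: left_part_def right_part_def incl_B_def incl_H_def)

lemma parts_linear:
  assumes "F \<in> linear_maps K V V"
  shows "L F \<in> linear_maps K B B" "R F \<in> linear_maps K H B"
proof -
  note F = to_B_linear[THEN linear_maps_compose, OF assms[THEN linear_maps_compose]]
  show "L F \<in> linear_maps K B B" unfolding left_part_def incl_B_def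
    by (intro linear_maps_restrict modules F linear_maps_tens_left linear_maps_id closed)
  show "R F \<in> linear_maps K H B" unfolding right_part_def incl_H_def
    by (intro linear_maps_restrict modules F linear_maps_tens_right linear_maps_id closed)
qed

text \<open>
  Write \<open>F(x)\<close> through its two projections. As \<open>F\<close> is a coalgebra map, the coproduct of \<open>F(x)\<close> is
  \<open>F(x\<^sub>(\<^sub>1\<^sub>)) \<otimes> F(x\<^sub>(\<^sub>2\<^sub>))\<close>, and as \<open>\<pi> \<circ> F = \<pi>\<close> the second factor does not see \<open>F\<close>. So \<open>F\<close> is
  determined by \<open>\<Pi> \<circ> F\<close>.
\<close>

lemma automorphism_collapse:
  assumes F: "F \<in> carrier G" and b: "b \<in> carrier B" and h: "h \<in> carrier H"
  shows "F (b \<sharp> h) = tensor_sum V (comult H h) (\<lambda>h1 h2. to_B (F (b \<sharp> h1)) \<sharp> h2)"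
proof -
  note M = modules(1-4) and F_in = Aut_Hopf_piD(4)[OF F]
  let ?x = "b \<sharp> h"
  have x: "?x \<in> carrier V" using b h by (rule closed)
  have Dx: "comult A ?x \<in> carrier VV" by (rule linear_mapsD(1)[OF biproduct_comult_linear x])
  have B: "(\<lambda>u v. to_B u \<sharp> to_H v) \<in> bilinear_maps K V V V"
    by (rule tensor_map_bilinear[OF M(2,1) to_B_linear to_H_linear])
  have "F ?x = tensor_sum V (tensor_sum VV (comult A ?x) (\<lambda>u v. tens K V V (F u) (F v)))
    (\<lambda>u v. to_B u \<sharp> to_H v)"
    using comult_reconstruct[OF F_in[OF x]] unfolding Aut_Hopf_piD(7)[OF F x] by (rule HOL.sym)
  also have "\<dots> = tensor_sum V (comult A ?x) (\<lambda>u v. to_B (F u) \<sharp> to_H v)"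
    by (intro HOL.trans[OF tensor_sum_tensor_sum[OF M(3,3,3,3,3) B Dx]] tensor_sum_cong[OF M(3,3) Dx]
      closed F_in
        HOL.trans[OF tensor_sum_tens[OF M(3,3,3) B]] arg_cong2[where f = "tens K B H"] HOL.refl
          Aut_Hopf_piD(8)[OF F])
  also have "\<dots> = tensor_sum V (comult H h) (\<lambda>h1 h2. to_B (F (b \<sharp> h1)) \<sharp> h2)"
    by (rule comult_cross_collapse[OF to_B_linear[THEN linear_maps_compose, OF Aut_Hopf_piD(3)[OF F]]
      b h])
  finally show ?thesis .
qed

text \<open>
  \<open>F\<close> maps \<open>B \<times> 1\<close> into itself, because \<open>1\<close> is group-like.
\<close>

lemma automorphism_B:
  assumes F: "F \<in> carrier G" and b: "b \<in> carrier B"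
  shows "F (b \<sharp> \<one>\<^bsub>H\<^esub>) = L F b \<sharp> \<one>\<^bsub>H\<^esub>"
proof -
  have bil: "(\<lambda>h1 h2. to_B (F (b \<sharp> h1)) \<sharp> h2) \<in> bilinear_maps K H H V"
    by (intro tensor_map_bilinear[OF modules(2,1) _ linear_maps_id]
        to_B_linear[THEN linear_maps_compose, OF Aut_Hopf_piD(3)[OF F, THEN linear_maps_compose]]
        linear_maps_tens_right linear_maps_id b modules)
  show ?thesis
    using automorphism_collapse[OF F b one_H_closed]
    unfolding comult_H_one tensor_sum_tens[OF modules(1,1,3) bil one_H_closed one_H_closed]
      left_part_eq[OF b] .
qed

lemma to_B_mult_B:
  assumes b: "b \<in> carrier B" and y: "y \<in> carrier V"
  shows "to_B ((b \<sharp> \<one>\<^bsub>H\<^esub>) \<otimes>\<^bsub>A\<^esub> y) = b \<otimes>\<^bsub>B\<^esub> to_B y"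
proof (rule linear_maps_tensor_eqI[OF modules(2,1,2) _ _ _ y])
  show "(\<lambda>y. to_B ((b \<sharp> \<one>\<^bsub>H\<^esub>) \<otimes>\<^bsub>A\<^esub> y)) \<in> linear_maps K V B"
    by (rule linear_maps_compose[OF to_B_linear
      bilinear_mapsD(1)[OF biproduct_mult_bilinear cross_closed[OF b one_H_closed]]])
  show "(\<lambda>y. b \<otimes>\<^bsub>B\<^esub> to_B y) \<in> linear_maps K V B"
    by (rule linear_maps_mult_right[OF to_B_linear b algebras(2)])
next
  fix b' h assume "b' \<in> carrier B" "h \<in> carrier H"
  then show "to_B ((b \<sharp> \<one>\<^bsub>H\<^esub>) \<otimes>\<^bsub>A\<^esub> (b' \<sharp> h)) = b \<otimes>\<^bsub>B\<^esub> to_B (b' \<sharp> h)"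
    using b by (simp only: cross_one_mult to_B_cross closed
      unital_algebra.smult_mult_right[OF algebras(2)])
qed

text \<open>
  Factor \<open>b \<times> h = (b \<times> 1)(1 \<times> h)\<close>, use that \<open>F\<close> is multiplicative, and use that \<open>\<Pi>\<close> commutes with
  left multiplication by elements of \<open>B \<times> 1\<close>.
\<close>

lemma to_B_automorphism:
  assumes F: "F \<in> carrier G" and b: "b \<in> carrier B" and h: "h \<in> carrier H"
  shows "to_B (F (b \<sharp> h)) = L F b \<otimes>\<^bsub>B\<^esub> R F h"
proof -
  have Lb: "L F b \<in> carrier B" by (rule linear_mapsD(1)[OF parts_linear(1)[OF Aut_Hopf_piD(3)[OF F]] b])
  have "b \<sharp> h = (b \<sharp> \<one>\<^bsub>H\<^esub>) \<otimes>\<^bsub>A\<^esub> (\<one>\<^bsub>B\<^esub> \<sharp> h)"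
    using b h by (simp add: cross_one_mult closed)
  then have "F (b \<sharp> h) = (L F b \<sharp> \<one>\<^bsub>H\<^esub>) \<otimes>\<^bsub>A\<^esub> F (\<one>\<^bsub>B\<^esub> \<sharp> h)"
    using b h by (simp only: Aut_Hopf_piD(5)[OF F] closed automorphism_B[OF F])
  then show ?thesis
    using Lb h by (simp only: to_B_mult_B closed Aut_Hopf_piD(4)[OF F] right_part_eq)
qed

lemma automorphism_formula:
  assumes F: "F \<in> carrier G" and b: "b \<in> carrier B" and h: "h \<in> carrier H"
  shows "F (b \<sharp> h) = tensor_sum V (comult H h) (\<lambda>h1 h2. (L F b \<otimes>\<^bsub>B\<^esub> R F h1) \<sharp> h2)"
  unfolding automorphism_collapse[OF F b h]
  by (rule tensor_sum_cong[OF modules(1,1) comult_H_closed[OF h]])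
    (simp only: to_B_automorphism[OF F b])

text \<open>
  The next two lemmas say that \<open>F \<mapsto> (F\<^sub>R, F\<^sub>L)\<close> turns composition into the semidirect product with
  opposite convolution.
\<close>

lemma left_part_mult:
  assumes F: "F \<in> carrier G" and F': "F' \<in> carrier G"
  shows "L (F \<otimes>\<^bsub>G\<^esub> F') = compose (carrier B) (L F) (L F')"
proof (rule extensionalityI[OF left_part_extensional compose_extensional])
  fix b assume b: "b \<in> carrier B"
  have "L F' b \<in> carrier B" by (rule linear_mapsD(1)[OF parts_linear(1)[OF Aut_Hopf_piD(3)[OF F']] b])
  then show "L (F \<otimes>\<^bsub>G\<^esub> F') b = compose (carrier B) (L F) (L F') b"
    using b by (simp only: left_part_eq[of b "compose (carrier V) F F'"] Aut_Hopf_pi_mult[OF F F']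
      compose_eq closed automorphism_B[OF F']
       left_part_eq[of "L F' b" F])
qed

text \<open>
  Apply \<open>\<Pi> \<circ> F\<close> to \<open>F'(1 \<times> h) = F'\<^sub>R(h\<^sub>(\<^sub>1\<^sub>)) \<times> h\<^sub>(\<^sub>2\<^sub>)\<close>. The factor of \<open>F'\<close> comes first, which is
  why the opposite group appears.
\<close>

lemma right_part_mult:
  assumes F: "F \<in> carrier G" and F': "F' \<in> carrier G"
  shows "R (F \<otimes>\<^bsub>G\<^esub> F') = conv H B (compose (carrier H) (L F) (R F')) (R F)"
proof (rule extensionalityI[OF right_part_extensional])
  show "conv H B (compose (carrier H) (L F) (R F')) (R F) \<in> extensional (carrier H)"
    by (simp add: conv_def)
next
  fix h assume h: "h \<in> carrier H"
  note M = modules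
  note R' = linear_mapsD(1)[OF parts_linear(2)[OF Aut_Hopf_piD(3)[OF F']]]
  have one: "\<one>\<^bsub>B\<^esub> \<sharp> h \<in> carrier V" using h by (intro closed)
  have "R (F \<otimes>\<^bsub>G\<^esub> F') h = to_B (F (tensor_sum V (comult H h) (\<lambda>h1 h2. to_B (F' (\<one>\<^bsub>B\<^esub> \<sharp> h1)) \<sharp> h2)))"
    using one h by (simp add: right_part_eq Aut_Hopf_pi_mult[OF F F'] compose_def flip:
      automorphism_collapse[OF F' one_B_closed h])
  also have "\<dots> = tensor_sum B (comult H h) (\<lambda>h1 h2. to_B (F (to_B (F' (\<one>\<^bsub>B\<^esub> \<sharp> h1)) \<sharp> h2)))"
    by (intro linear_map_tensor_sum[OF M(1,1,3,2)
      to_B_linear[THEN linear_maps_compose, OF Aut_Hopf_piD(3)[OF F]]]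
      closed h linear_mapsD(1)[OF to_B_linear] Aut_Hopf_piD(4)[OF F'])
  also have "\<dots> = tensor_sum B (comult H h) (\<lambda>h1 h2. compose (carrier H) (L F) (R F') h1 \<otimes>\<^bsub>B\<^esub> R F h2)"
    by (intro tensor_sum_cong[OF M(1,1) comult_H_closed[OF h]])
      (simp add: to_B_automorphism[OF F] R' compose_def flip: right_part_eq)
  finally show "R (F \<otimes>\<^bsub>G\<^esub> F') h = conv H B (compose (carrier H) (L F) (R F')) (R F) h"
    using h by (simp add: conv_def)
qed

section \<open>Automorphisms of the biproduct from automorphisms of B\<close>

abbreviation N where "N \<equiv> N_group K H B act coact"

lemma Phi_summand_bilinear:
  assumes f: "f \<in> linear_maps K B B" and g: "g \<in> linear_maps K H B"
  shows "(\<lambda>b h. tensor_sum V (comult H h) (\<lambda>h1 h2. (f b \<otimes>\<^bsub>B\<^esub> g h1) \<sharp> h2)) \<in> bilinear_maps K B H V"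
  by (rule multilinear f[THEN linear_maps_compose] g[THEN linear_maps_compose]
      f[THEN linear_mapsD(1)] g[THEN linear_mapsD(1)] | assumption)+

lemma Phi_eq:
  "\<Phi> (g, f) = (\<lambda>x\<in>carrier V. tensor_sum V x
    (\<lambda>b h. tensor_sum V (comult H h) (\<lambda>h1 h2. (f b \<otimes>\<^bsub>B\<^esub> g h1) \<sharp> h2)))"
  unfolding Phi_YD_def tensor_product_biproduct(3) biproduct_fields(1) by simp

lemma Phi_extensional: "\<Phi> (g, f) \<in> extensional (carrier V)"
  unfolding Phi_eq by (rule restrict_extensional)

lemma Phi_linear:
  assumes "f \<in> linear_maps K B B" "g \<in> linear_maps K H B"
  shows "\<Phi> (g, f) \<in> linear_maps K V V"
  unfolding Phi_eq
  by (intro linear_maps_restrict modules tensor_sum_linear Phi_summand_bilinear assms)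

lemma Phi_cross:
  assumes "f \<in> linear_maps K B B" "g \<in> linear_maps K H B" and b: "b \<in> carrier B" and h: "h \<in> carrier H"
  shows "\<Phi> (g, f) (b \<sharp> h) = tensor_sum V (comult H h) (\<lambda>h1 h2. (f b \<otimes>\<^bsub>B\<^esub> g h1) \<sharp> h2)"
  unfolding Phi_eq restrict_apply' [OF cross_closed[OF b h]]
  by (rule tensor_sum_tens[OF modules(2,1,3) Phi_summand_bilinear[OF assms(1,2)] b h])

text \<open>
  Every automorphism over \<open>\<pi>\<close> is given by the formula for \<open>\<Phi>\<close>, applied to its own parts.
\<close>

lemma Phi_parts:
  assumes F: "F \<in> carrier G"
  shows "\<Phi> (R F, L F) = F"
  by (rule biproduct_map_eqI) (simp_all only: Phi_extensional Aut_Hopf_piD[OF F] Phi_linear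
    parts_linear Phi_cross automorphism_formula[OF F])

lemma Aut_YD_HopfD:
  assumes "f \<in> carrier YD"
  shows "f \<in> extensional (carrier B)" "bij_betw f (carrier B) (carrier B)" "f \<in> linear_maps K B B"
    and "\<And>b. b \<in> carrier B \<Longrightarrow> f b \<in> carrier B"
    and "\<And>b b'. \<lbrakk>b \<in> carrier B; b' \<in> carrier B\<rbrakk> \<Longrightarrow> f (b \<otimes>\<^bsub>B\<^esub> b') = f b \<otimes>\<^bsub>B\<^esub> f b'"
    and "f \<one>\<^bsub>B\<^esub> = \<one>\<^bsub>B\<^esub>"
    and "\<And>b. b \<in> carrier B \<Longrightarrow> comult B (f b) =
      tensor_sum (tensor_product K B B) (comult B b) (\<lambda>b1 b2. tens K B B (f b1) (f b2))"
    and "\<And>b. b \<in> carrier B \<Longrightarrow> counit B (f b) = counit B b"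
    and "\<And>h b. \<lbrakk>h \<in> carrier H; b \<in> carrier B\<rbrakk> \<Longrightarrow> f (act h b) = act h (f b)"
    and "\<And>b. b \<in> carrier B \<Longrightarrow> coact (f b) =
         tensor_sum (tensor_product K H B) (coact b) (\<lambda>x b0. tens K H B x (f b0))"
  using assms unfolding Aut_YD_Hopf_def Bij_def algebra_maps_def coalgebra_maps_def
  by (auto simp: ring_hom_def linear_maps_def)

lemma Aut_YD_Hopf_mult:
  assumes "f \<in> carrier YD" "f' \<in> carrier YD"
  shows "f \<otimes>\<^bsub>YD\<^esub> f' = compose (carrier B) f f'"
  using Aut_YD_HopfD(1,2)[OF assms(1)] Aut_YD_HopfD(1,2)[OF assms(2)]
  by (simp add: Aut_YD_Hopf_def BijGroup_def Bij_def)

lemma Aut_YD_Hopf_one: "\<one>\<^bsub>YD\<^esub> = (\<lambda>x\<in>carrier B. x)"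
  by (simp add: Aut_YD_Hopf_def BijGroup_def)

lemma conv_one_linear: "conv_one H B \<in> linear_maps K H B"
  unfolding conv_one_def
  by (intro linear_maps_restrict linear_maps_smult_left counit_linears modules closed)

text \<open>
  At the convolution unit, \<open>\<Phi>\<close> is \<open>f \<mapsto> f \<otimes> id\<close>: the counit law of \<open>H\<close> collapses the sum. The lemmas
  that follow show that \<open>f \<otimes> id\<close> respects the structure of the biproduct. Linearity over \<open>H\<close> is what
  the product needs, colinearity is what the coproduct needs.
\<close>

lemma extend_cross:
  assumes f: "f \<in> linear_maps K B B" and b: "b \<in> carrier B" and h: "h \<in> carrier H"
  shows "\<Phi> (conv_one H B, f) (b \<sharp> h) = f b \<sharp> h"
proof -
  note fb = linear_mapsD(1)[OF f b]
  have "\<Phi> (conv_one H B, f) (b \<sharp> h) = tensor_sum V (comult H h) (\<lambda>h1 h2. (counit H h1 \<odot>\<^bsub>B\<^esub> f b) \<sharp> h2)"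
    unfolding Phi_cross[OF f conv_one_linear b h]
    by (rule tensor_sum_cong[OF modules(1,1) comult_H_closed[OF h]])
      (simp add: conv_one_def closed fb unital_algebra.smult_mult_right[OF algebras(2)])
  then show ?thesis using counit_collapse[OF fb h] by simp
qed

lemma extend_mult:
  assumes f: "f \<in> carrier YD" and b: "b \<in> carrier B" "h \<in> carrier H" "b' \<in> carrier B" "h' \<in> carrier H"
  shows "\<Phi> (conv_one H B, f) ((b \<sharp> h) \<otimes>\<^bsub>A\<^esub> (b' \<sharp> h')) = (f b \<sharp> h) \<otimes>\<^bsub>A\<^esub> (f b' \<sharp> h')"
proof -
  note fD = Aut_YD_HopfD[OF f]
  have "\<Phi> (conv_one H B, f) ((b \<sharp> h) \<otimes>\<^bsub>A\<^esub> (b' \<sharp> h')) =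
    tensor_sum V (comult H h) (\<lambda>h1 h2. \<Phi> (conv_one H B, f) ((b \<otimes>\<^bsub>B\<^esub> act h1 b') \<sharp> (h2 \<otimes>\<^bsub>H\<^esub> h')))"
    unfolding biproduct_mult[OF b]
    by (intro linear_map_tensor_sum[OF modules(1,1,3,3) Phi_linear[OF fD(3) conv_one_linear]] closed b)
  also have "\<dots> = mult_summand (f b) h (f b') h'"
    by (intro tensor_sum_cong[OF modules(1,1)] closed b)
      (simp only: extend_cross[OF fD(3)] closed b fD(4,5,9))
  also have "\<dots> = (f b \<sharp> h) \<otimes>\<^bsub>A\<^esub> (f b' \<sharp> h')"
    by (simp only: biproduct_mult fD(4) b)
  finally show ?thesis .
qed

lemma extend_comult:
  assumes f: "f \<in> carrier YD" and b: "b \<in> carrier B" and h: "h \<in> carrier H"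
  shows "comult A (f b \<sharp> h) = tensor_sum VV (comult A (b \<sharp> h))
    (\<lambda>u v. tens K V V (\<Phi> (conv_one H B, f) u) (\<Phi> (conv_one H B, f) v))"
proof -
  note M = modules(1-4) and fD = Aut_YD_HopfD[OF f]
  let ?P = "\<Phi> (conv_one H B, f)"
  have P: "?P \<in> linear_maps K V V" by (rule Phi_linear[OF fD(3) conv_one_linear])
  have PP: "(\<lambda>u v. tens K V V (?P u) (?P v)) \<in> bilinear_maps K V V VV"
    by (rule tensor_map_bilinear[OF M(3,3) P P])
  have bil1: "(\<lambda>b1 b2. tensor_sum VV (coact b2) (\<lambda>y c.
     tensor_sum VV (comult H h) (\<lambda>h1 h2. tens K V V (b1 \<sharp> (y \<otimes>\<^bsub>H\<^esub> h1)) (c \<sharp> h2)))) \<in> bilinear_maps K B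
       B VV"
    using h by - (rule multilinear | assumption)+
  have bil2: "(\<lambda>y c. tensor_sum VV (comult H h) (\<lambda>h1 h2. tens K V V (b1 \<sharp> (y \<otimes>\<^bsub>H\<^esub> h1)) (c \<sharp> h2))) \<in>
    bilinear_maps K H B VV"
    if "b1 \<in> carrier B" for b1
    using h that by - (rule multilinear | assumption)+
  have "comult A (f b \<sharp> h) = tensor_sum VV (comult B b) (\<lambda>b1 b2. tensor_sum VV (coact (f b2)) (\<lambda>y c.
     tensor_sum VV (comult H h) (\<lambda>h1 h2. tens K V V (f b1 \<sharp> (y \<otimes>\<^bsub>H\<^esub> h1)) (c \<sharp> h2))))"
    unfolding biproduct_comult[OF fD(4)[OF b] h] fD(7)[OF b]
    by (intro HOL.trans[OF tensor_sum_tensor_sum[OF M(2,2,2,2,4) bil1]] closed tens_closed modules b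
      fD(4)
      tensor_sum_cong[OF M(2,2)] tensor_sum_tens[OF M(2,2,4) bil1])
  also have "\<dots> = tensor_sum VV (comult B b) (\<lambda>b1 b2. tensor_sum VV (coact b2) (\<lambda>y c.
     tensor_sum VV (comult H h) (\<lambda>h1 h2. tens K V V (f b1 \<sharp> (y \<otimes>\<^bsub>H\<^esub> h1)) (f c \<sharp> h2))))"
  proof (intro tensor_sum_cong[OF M(2,2)] closed b)
    fix b1 b2 assume b12: "b1 \<in> carrier B" "b2 \<in> carrier B"
    show "tensor_sum VV (coact (f b2)) (\<lambda>y c.
       tensor_sum VV (comult H h) (\<lambda>h1 h2. tens K V V (f b1 \<sharp> (y \<otimes>\<^bsub>H\<^esub> h1)) (c \<sharp> h2))) =
      tensor_sum VV (coact b2) (\<lambda>y c.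
       tensor_sum VV (comult H h) (\<lambda>h1 h2. tens K V V (f b1 \<sharp> (y \<otimes>\<^bsub>H\<^esub> h1)) (f c \<sharp> h2)))"
      unfolding fD(10)[OF b12(2)]
      by (intro HOL.trans[OF tensor_sum_tensor_sum[OF M(1,2,1,2,4) bil2]] closed tens_closed modules
        b12 fD(4)
        tensor_sum_cong[OF M(1,2)] tensor_sum_tens[OF M(1,2,4) bil2])
  qed
  also have "\<dots> = tensor_sum VV (comult B b) (\<lambda>b1 b2. tensor_sum VV (coact b2) (\<lambda>y c.
     tensor_sum VV (comult H h) (\<lambda>h1 h2. tens K V V (?P (b1 \<sharp> (y \<otimes>\<^bsub>H\<^esub> h1))) (?P (c \<sharp> h2)))))"
    by (intro tensor_sum_cong[OF M(2,2)] tensor_sum_cong[OF M(1,2)] tensor_sum_cong[OF M(1,1)] closed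
      b h)
      (simp_all only: extend_cross[OF fD(3)] closed)
  also have "\<dots> = tensor_sum VV (comult_summand b h) (\<lambda>u v. tens K V V (?P u) (?P v))"
    using b h
    by (intro HOL.sym[OF HOL.trans[OF tensor_sum_tensor_sum[OF M(2,2,3,3,4) PP]]]
      tensor_sum_cong[OF M(2,2)]
      HOL.trans[OF tensor_sum_tensor_sum[OF M(1,2,3,3,4) PP]] tensor_sum_cong[OF M(1,2)]
      HOL.trans[OF tensor_sum_tensor_sum[OF M(1,1,3,3,4) PP]] tensor_sum_cong[OF M(1,1)]
      tensor_sum_tens[OF M(3,3,4) PP]
      tensor_sum_closed[OF M(1,2,4)] tensor_sum_closed[OF M(1,1,4)] closed)
  finally show ?thesis unfolding biproduct_comult[OF b h] .
qed

lemma extend_automorphism: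
  assumes f: "f \<in> carrier YD"
  shows "\<Phi> (conv_one H B, f) \<in> carrier G"
proof -
  note M = modules and fD = Aut_YD_HopfD[OF f]
  let ?P = "\<Phi> (conv_one H B, f)"
  have P: "?P \<in> linear_maps K V V" by (rule Phi_linear[OF fD(3) conv_one_linear])
  note P_in = linear_mapsD(1)[OF P] and P_cross = extend_cross[OF fD(3)]
  define f' where "f' = inv_into (carrier B) f"
  have f': "f' \<in> linear_maps K B B" unfolding f'_def by (rule linear_maps_inv_into[OF M(2) fD(3,2)])
  have f'f: "f' (f b) = b" "f (f' b) = b" if "b \<in> carrier B" for b
    unfolding f'_def using that
    by (rule bij_betw_inv_into_left[OF fD(2)], rule bij_betw_inv_into_right[OF fD(2)])
  let ?Q = "\<Phi> (conv_one H B, f')"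
  have Q: "?Q \<in> linear_maps K V V" by (rule Phi_linear[OF f' conv_one_linear])
  have QP: "?Q (?P x) = x" if "x \<in> carrier V" for x
    by (rule linear_maps_tensor_eqI[OF M(2,1,3) linear_maps_compose[OF Q P] linear_maps_id _ that])
      (simp only: P_cross extend_cross[OF f'] fD(4) f'f)
  have PQ: "?P (?Q x) = x" if "x \<in> carrier V" for x
    by (rule linear_maps_tensor_eqI[OF M(2,1,3) linear_maps_compose[OF P Q] linear_maps_id _ that])
      (simp only: P_cross extend_cross[OF f'] linear_mapsD(1)[OF f'] f'f)
  have mult1: "?P (x \<otimes>\<^bsub>A\<^esub> (b' \<sharp> h')) = ?P x \<otimes>\<^bsub>A\<^esub> ?P (b' \<sharp> h')"
    if "x \<in> carrier V" "b' \<in> carrier B" "h' \<in> carrier H" for x b' h'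
    by (rule linear_maps_tensor_eqI[OF M(2,1,3) _ _ _ that(1)])
      (rule P[THEN linear_maps_compose] biproduct_mult_bilinear[THEN bilinear_mapsD(2)]
       bilinear_mapsD(2)[OF biproduct_mult_bilinear, THEN linear_maps_compose, OF _ P]
       closed P_in that | simp only: P_cross extend_mult[OF f] that)+
  have mult: "?P (x \<otimes>\<^bsub>A\<^esub> y) = ?P x \<otimes>\<^bsub>A\<^esub> ?P y" if "x \<in> carrier V" "y \<in> carrier V" for x y
    by (rule linear_maps_tensor_eqI[OF M(2,1,3) _ _ _ that(2)])
      (rule P[THEN linear_maps_compose] biproduct_mult_bilinear[THEN bilinear_mapsD(1)]
       bilinear_mapsD(1)[OF biproduct_mult_bilinear, THEN linear_maps_compose, OF _ P]
       P_in mult1 that | assumption)+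
  have comult: "comult A (?P x) = tensor_sum VV (comult A x) (\<lambda>u v. tens K V V (?P u) (?P v))"
    if "x \<in> carrier V" for x
    by (rule linear_maps_tensor_eqI[OF M(2,1,4) linear_maps_compose[OF biproduct_comult_linear P] _ _
      that])
      (rule linear_maps_tensor_sum_left biproduct_comult_linear tensor_map_bilinear P M
        | simp only: P_cross extend_comult[OF f])+
  have counit: "counit A (?P x) = counit A x" if "x \<in> carrier V" for x
    by (rule linear_maps_tensor_eqI[OF M(2,1,5) linear_maps_compose[OF biproduct_counit_linear P]
      biproduct_counit_linear _ that])
      (simp only: P_cross biproduct_counit fD(4,8))
  have over: "to_H (?P x) = to_H x" if "x \<in> carrier V" for x
    by (rule linear_maps_tensor_eqI[OF M(2,1,1) linear_maps_compose[OF to_H_linear P] to_H_linear _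
      that])
      (simp only: P_cross to_H_cross fD(4,8))
  have "bij_betw ?P (carrier V) (carrier V)"
    by (rule bij_betw_byWitness[where f' = ?Q]) (auto simp only: QP PQ P_in linear_mapsD(1)[OF Q])
  moreover have "?P (\<one>\<^bsub>B\<^esub> \<sharp> \<one>\<^bsub>H\<^esub>) = \<one>\<^bsub>B\<^esub> \<sharp> \<one>\<^bsub>H\<^esub>"
    by (simp only: P_cross closed fD(6))
  ultimately show ?thesis
    unfolding Aut_Hopf_pi_iff using Phi_extensional P mult comult counit over by blast
qed

section \<open>The semidirect product decomposition\<close>

text \<open>
  The map \<open>F \<mapsto> (F\<^sub>R, F\<^sub>L)\<close> is shown to be an isomorphism, with inverse \<open>\<Phi>\<close>. Its target thereby
  inherits the group laws. This includes closure of \<open>\<N>(B, H)\<close> under convolution and under the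
  action.
\<close>

lemma semidirect_group_iso:
  assumes nu: "\<And>F. F \<in> carrier G \<Longrightarrow> L F \<in> carrier YD"
  defines "S \<equiv> semidirect_product (opposite_group N) YD (phi H)"
  shows "group S \<and> group G \<and> \<Phi> \<in> iso S G"
proof -
  interpret G: Group.group G by (rule group_Aut_Hopf_pi)
  have N: "g \<in> carrier N \<longleftrightarrow> (\<exists>F. F \<in> carrier G \<and> L F = (\<lambda>b\<in>carrier B. b) \<and> g = R F)" for g
    unfolding N_group_def by auto
  have S_carrier: "carrier S = carrier N \<times> carrier YD"
    and S_mult: "(g, f) \<otimes>\<^bsub>S\<^esub> (g', f') = (conv H B (compose (carrier H) f g') g, f \<otimes>\<^bsub>YD\<^esub> f')"
    and S_one: "\<one>\<^bsub>S\<^esub> = (conv_one H B, \<one>\<^bsub>YD\<^esub>)" for g f g' f'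
    by (simp_all add: S_def semidirect_product_def opposite_group_def N_group_def phi_def)
  let ?parts = "\<lambda>F. (R F, L F)" and ?ext = "\<lambda>f. \<Phi> (conv_one H B, f)"

  \<comment> \<open>composing with \<open>f \<otimes> id\<close> on the right changes \<open>F\<^sub>L\<close> only, as \<open>f(1) = 1\<close>\<close>
  have R_extend: "R (F \<otimes>\<^bsub>G\<^esub> ?ext f) = R F"
    and L_extend: "\<And>b. b \<in> carrier B \<Longrightarrow> L (F \<otimes>\<^bsub>G\<^esub> ?ext f) b = L F (f b)"
    if F: "F \<in> carrier G" and f: "f \<in> carrier YD" for F f
  proof -
    note fD = Aut_YD_HopfD[OF f] and FP = Aut_Hopf_pi_mult[OF F extend_automorphism[OF f]]
    show "R (F \<otimes>\<^bsub>G\<^esub> ?ext f) = R F"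
      by (rule extensionalityI[OF right_part_extensional right_part_extensional])
        (simp only: right_part_eq FP compose_eq closed extend_cross[OF fD(3)] fD(6))
    show "L (F \<otimes>\<^bsub>G\<^esub> ?ext f) b = L F (f b)" if "b \<in> carrier B" for b
      using that by (simp only: left_part_eq FP compose_eq closed extend_cross[OF fD(3)] fD(4))
  qed

  \<comment> \<open>if \<open>g = F\<^sub>R\<close> and \<open>F\<^sub>L\<close> is the identity, then \<open>\<Phi>(g, f) = F \<circ> (f \<otimes> id)\<close>\<close>
  have Phi_in: "\<Phi> (g, f) \<in> carrier G \<and> ?parts (\<Phi> (g, f)) = (g, f)"
    if g: "g \<in> carrier N" and f: "f \<in> carrier YD" for g f
  proof -
    note fD = Aut_YD_HopfD[OF f]
    obtain F where F: "F \<in> carrier G" "L F = (\<lambda>b\<in>carrier B. b)" "g = R F" using g N by blast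
    have in_G: "F \<otimes>\<^bsub>G\<^esub> ?ext f \<in> carrier G" by (intro G.m_closed F extend_automorphism f)
    have "L (F \<otimes>\<^bsub>G\<^esub> ?ext f) = f"
      by (rule extensionalityI[OF left_part_extensional fD(1)])
        (simp add: L_extend[OF F(1) f] F(2) fD(4))
    then have "\<Phi> (g, f) = F \<otimes>\<^bsub>G\<^esub> ?ext f"
      using Phi_parts[OF in_G] R_extend[OF F(1) f] F(3) by simp
    then show ?thesis
      using in_G R_extend[OF F(1) f] \<open>L _ = f\<close> F(3) by simp
  qed

  \<comment> \<open>\<open>F\<^sub>R\<close> belongs to \<open>\<N>(B, H)\<close> because it is also the right part of \<open>F \<circ> (F\<^sub>L \<otimes> id)\<^sup>-\<^sup>1\<close>, whose left part
     is the identity; the assumption on \<open>\<nu>\<close> makes \<open>F\<^sub>L \<otimes> id\<close> an automorphism\<close>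
  have parts_in: "?parts F \<in> carrier S" if F: "F \<in> carrier G" for F
  proof -
    note f = nu[OF F]
    let ?P = "?ext (L F)"
    have P: "?P \<in> carrier G" by (rule extend_automorphism[OF f])
    define F' where "F' = F \<otimes>\<^bsub>G\<^esub> inv\<^bsub>G\<^esub> ?P"
    have F': "F' \<in> carrier G" and F'P: "F' \<otimes>\<^bsub>G\<^esub> ?P = F"
      using F P by (simp_all add: F'_def G.m_assoc)
    have "L F' c = c" if c: "c \<in> carrier B" for c
    proof -
      obtain b where "b \<in> carrier B" "c = L F b"
        using Aut_YD_HopfD(2)[OF f] c unfolding bij_betw_def by blast
      then show ?thesis using L_extend[OF F' f, of b] F'P by simp
    qed
    then have "L F' = (\<lambda>b\<in>carrier B. b)"
      by (intro extensionalityI[OF left_part_extensional restrict_extensional]) simp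
    moreover have "R F = R F'" using R_extend[OF F' f] F'P by simp
    ultimately show ?thesis using F' f N S_carrier by auto
  qed

  have bij: "bij_betw ?parts (carrier G) (carrier S)"
    by (rule bij_betw_byWitness[where f' = \<Phi>]) (use Phi_in parts_in Phi_parts S_carrier in auto)
  have hom: "?parts (F \<otimes>\<^bsub>G\<^esub> F') = ?parts F \<otimes>\<^bsub>S\<^esub> ?parts F'"
    if "F \<in> carrier G" "F' \<in> carrier G" for F F'
    using that by (simp add: S_mult right_part_mult left_part_mult Aut_YD_Hopf_mult nu)
  have iso: "?parts \<in> iso G S"
    using bij hom parts_in by (auto simp: iso_def hom_def)

  have "?parts \<one>\<^bsub>G\<^esub> = \<one>\<^bsub>S\<^esub>"
  proof -
    have "R (\<lambda>x\<in>carrier V. x) = conv_one H B"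
      by (rule extensionalityI[OF right_part_extensional])
        (simp_all add: conv_one_def right_part_eq closed to_B_cross)
    moreover have "L (\<lambda>x\<in>carrier V. x) = (\<lambda>b\<in>carrier B. b)"
      by (rule extensionalityI[OF left_part_extensional restrict_extensional])
        (simp add: left_part_eq closed to_B_cross counit_one)
    ultimately show ?thesis by (simp only: Aut_Hopf_pi_one S_one Aut_YD_Hopf_one)
  qed
  then have "group S"
    using G.iso_imp_img_group[OF iso] by simp
  moreover have "\<Phi> \<in> iso S G"
  proof (rule isoI)
    have eq: "inv_into (carrier G) ?parts s = \<Phi> s" if "s \<in> carrier S" for s
      using Phi_in that S_carrier by (intro inv_into_f_eq bij_betw_imp_inj_on[OF bij]) auto
    note sym = G.iso_set_sym[OF iso]
    show "bij_betw \<Phi> (carrier S) (carrier G)"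
      using sym bij_betw_cong[of "carrier S" "inv_into (carrier G) ?parts" \<Phi>, OF eq]
        by (simp add: iso_def)
    show "\<Phi> \<in> hom S G"
    proof (rule homI)
      fix s t assume s: "s \<in> carrier S" and t: "t \<in> carrier S"
      show "\<Phi> s \<in> carrier G" using Phi_in s S_carrier by auto
      have st: "s \<otimes>\<^bsub>S\<^esub> t \<in> carrier S" using \<open>group S\<close> s t
        by (simp add: Group.group.is_monoid Group.monoid.m_closed)
      have "inv_into (carrier G) ?parts (s \<otimes>\<^bsub>S\<^esub> t) =
          inv_into (carrier G) ?parts s \<otimes>\<^bsub>G\<^esub> inv_into (carrier G) ?parts t"
        using sym s t by (auto simp: iso_def hom_def)
      then show "\<Phi> (s \<otimes>\<^bsub>S\<^esub> t) = \<Phi> s \<otimes>\<^bsub>G\<^esub> \<Phi> t"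
        by (simp only: eq[OF st] eq[OF s] eq[OF t])
    qed
  qed
  ultimately show ?thesis using group_Aut_Hopf_pi by simp
qed

end

theorem corollary6:
  fixes K :: "('k, 'r) ring_scheme"
    and H :: "('k, 'h, 'm) coalg_scheme"
    and B :: "('k, 'b, 'n) coalg_scheme"
    and act :: "'h \<Rightarrow> 'b \<Rightarrow> 'b"
    and coact :: "'b \<Rightarrow> ('h, 'b) tens"
  assumes "field K" and "hopf_algebra K H" and "biproduct_datum K H B act coact"
    and "nu K H B ` carrier (Aut_Hopf_pi K H B act coact) \<subseteq> carrier (Aut_YD_Hopf K H B act coact)"
  shows "group (semidirect_product (opposite_group (N_group K H B act coact))
            (Aut_YD_Hopf K H B act coact) (phi H)) \<and>
         group (Aut_Hopf_pi K H B act coact) \<and>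
         Phi_YD K H B act coact \<in>
           iso (semidirect_product (opposite_group (N_group K H B act coact))
                 (Aut_YD_Hopf K H B act coact) (phi H))
               (Aut_Hopf_pi K H B act coact)"
  using assms(4) by (intro biproduct_datum.semidirect_group_iso[OF assms(3)]) (auto simp: nu_def)

end
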